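(* Let $(N,v)$ be a knapsack budgeted game with representation $(\{(l_1,w_1),\ldots,(l_{|N|},w_{|N|})\}, l_{\mathrm{bin}})$, let $w_{\max}=\lceil l_{\mathrm{bin}}\cdot \max_k w_k/l_k\rceil$, and let $\epsilon>0$. Then for any given agent $i$, a number $\tilde\phi_i$ with $|\tilde\phi_i-\phi_i(v)|\le \epsilon\, w_{\max}$ can be computed in time $O\big((l_{\mathrm{bin}}^2/\epsilon+1)^{l_{\mathrm{bin}}+1}|N|^2\big)$.
   Context: A cooperative game $(N,v)$ consists of a finite set $N$ of agents and a function $v:2^N\to\mathbb R$ with $v(\emptyset)=0$. The Shapley value of agent $i$ is $\phi_i(v)=\sum_{S\subseteq N\setminus\{i\}}\frac{|S|!\,(|N|-|S|-1)!}{|N|!}\big(v(S\cup\{i\})-v(S)\big)$. A knapsack budgeted game is a cooperative game $(N,v)$, with agents labeled $1,\ldots,|N|$, given by nonnegative integers $(\{(l_1,w_1),\ldots,(l_{|N|},w_{|N|})\}, l_{\mathrm{bin}})$ with $0<l_i\le l_{\mathrm{bin}}$ for all $i$, such that $v(S)=\max_{S'\subseteq S:\ l(S')\le l_{\mathrm{bin}}} w(S')$ for all $S\subseteq N$, where $l(S')=\sum_{k\in S'}l_k$ and $w(S')=\sum_{k\in S'}w_k$. Running times count arithmetic operations at unit cost. *)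

theory Defs
  imports Complex_Main
begin

definition knap_val :: "(nat \<Rightarrow> nat) \<Rightarrow> (nat \<Rightarrow> nat) \<Rightarrow> nat \<Rightarrow> nat set \<Rightarrow> real" where
  "knap_val l w lbin S = Max {real (\<Sum>k\<in>S'. w k) | S'. S' \<subseteq> S \<and> (\<Sum>k\<in>S'. l k) \<le> lbin}"

definition shapley :: "nat set \<Rightarrow> (nat set \<Rightarrow> real) \<Rightarrow> nat \<Rightarrow> real" where
  "shapley N v i = (\<Sum>S\<in>Pow (N - {i}).
      (fact (card S) * fact (card N - card S - 1) / fact (card N)) * (v (S \<union> {i}) - v S))"

definition w_max :: "nat \<Rightarrow> (nat \<Rightarrow> nat) \<Rightarrow> (nat \<Rightarrow> nat) \<Rightarrow> nat \<Rightarrow> int" where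
  "w_max n l w lbin = \<lceil>real lbin * Max ((\<lambda>k. real (w k) / real (l k)) ` {1..n})\<rceil>"

type_synonym mem = "nat \<Rightarrow> real"

datatype aop = Add | Sub | Mul | Dvd

fun apply_op :: "aop \<Rightarrow> real \<Rightarrow> real \<Rightarrow> real" where
  "apply_op Add x y = x + y"
| "apply_op Sub x y = x - y"
| "apply_op Mul x y = x * y"
| "apply_op Dvd x y = x / y"

datatype com =
    SKIP
  | SetConst nat int
  | SetOp nat aop nat nat
  | SetFloor nat nat
  | LoadInd nat nat
  | StoreInd nat nat
  | Seq com com
  | IfPos nat com com
  | WhilePos nat com

inductive exec :: "com \<Rightarrow> mem \<Rightarrow> nat \<Rightarrow> mem \<Rightarrow> bool" where
  Skip: "exec SKIP m 0 m"
| SetConst: "exec (SetConst a c) m 1 (m(a := real_of_int c))"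
| SetOp: "exec (SetOp a f b c) m 1 (m(a := apply_op f (m b) (m c)))"
| SetFloor: "exec (SetFloor a b) m 1 (m(a := real_of_int \<lfloor>m b\<rfloor>))"
| LoadInd: "exec (LoadInd a b) m 1 (m(a := m (nat \<lfloor>m b\<rfloor>)))"
| StoreInd: "exec (StoreInd a b) m 1 (m(nat \<lfloor>m a\<rfloor> := m b))"
| Seq: "exec c1 m t1 m1 \<Longrightarrow> exec c2 m1 t2 m2 \<Longrightarrow> exec (Seq c1 c2) m (t1 + t2) m2"
| IfT: "m a > 0 \<Longrightarrow> exec c1 m t m' \<Longrightarrow> exec (IfPos a c1 c2) m (Suc t) m'"
| IfF: "\<not> m a > 0 \<Longrightarrow> exec c2 m t m' \<Longrightarrow> exec (IfPos a c1 c2) m (Suc t) m'"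
| WhileF: "\<not> m a > 0 \<Longrightarrow> exec (WhilePos a c) m 1 m"
| WhileT: "m a > 0 \<Longrightarrow> exec c m t1 m1 \<Longrightarrow> exec (WhilePos a c) m1 t2 m2 \<Longrightarrow>
           exec (WhilePos a c) m (Suc (t1 + t2)) m2"

text \<open>Input encoding: m[0] = n, m[1] = lbin, m[2] = i, m[3] = eps,
  m[2k+2] = l k and m[2k+3] = w k for k = 1..n, all other cells 0.
  The output is the content of cell 0 upon termination.\<close>

definition init_mem :: "nat \<Rightarrow> (nat \<Rightarrow> nat) \<Rightarrow> (nat \<Rightarrow> nat) \<Rightarrow> nat \<Rightarrow> nat \<Rightarrow> real \<Rightarrow> mem" where
  "init_mem n l w lbin i eps = (\<lambda>a.
      if a = 0 then real n
      else if a = 1 then real lbin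
      else if a = 2 then real i
      else if a = 3 then eps
      else if even a \<and> 1 \<le> (a - 2) div 2 \<and> (a - 2) div 2 \<le> n then real (l ((a - 2) div 2))
      else if odd a \<and> 1 \<le> (a - 3) div 2 \<and> (a - 3) div 2 \<le> n then real (w ((a - 3) div 2))
      else 0)"

end

theory Submission
  imports Defs
begin

text \<open>Let \<open>\<rho> = max w\<^sub>k / l\<^sub>k\<close> and round every weight down to a multiple of \<open>U = \<epsilon> \<rho>\<close>. A feasible set has at
  most \<open>l\<^sub>b\<^sub>i\<^sub>n\<close> members, so rounding lowers each coalition value by at most \<open>l\<^sub>b\<^sub>i\<^sub>n U \<le> \<epsilon> w\<^sub>m\<^sub>a\<^sub>x\<close>, and the
  same bound holds for marginal contributions and hence for their mean, the Shapley value. After rounding,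
  the knapsack table \<open>c \<mapsto> T c\<close> (best weight within capacity \<open>c \<le> l\<^sub>b\<^sub>i\<^sub>n\<close>) of a coalition has entries below
  \<open>b = \<lfloor>l\<^sub>b\<^sub>i\<^sub>n / \<epsilon>\<rfloor> + 1\<close>, so the table and the size \<open>s\<close> of the coalition fit into the number
  \<open>x = s B + (\<Sum>c. T c * b ^ c)\<close> with \<open>B = b ^ (l\<^sub>b\<^sub>i\<^sub>n + 1)\<close>.

  The Shapley value averages over a random coalition that is grown agent by agent: if \<open>s\<close> of the agents
  \<open>1, \<dots>, k - 1\<close> precede \<open>i\<close> in a random order, then agent \<open>k\<close> does so with probability
  \<open>(s + 1) / (k + 1)\<close>. Backward induction along this process computes the mean: start with
  \<open>F x\<close> = marginal contribution of \<open>i\<close> in state \<open>x\<close>, and for \<open>k = n, \<dots>, 1\<close> replace \<open>F x\<close> by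
  \<open>((s + 1) * F x' + (k - s) * F x) / (k + 1)\<close>, where \<open>x'\<close> is the state after adding \<open>k\<close>; then
  \<open>U * F 0\<close> is the answer. Agent \<open>i\<close> itself is kept in the loop as a null agent with \<open>l\<^sub>i = w\<^sub>i = 0\<close>,
  which does not affect the mean. For \<open>\<epsilon> \<ge> 1\<close> the answer \<open>0\<close> is good enough; this case must be
  separated because the time bound then leaves no room for a factor \<open>l\<^sub>b\<^sub>i\<^sub>n\<close>.\<close>

section \<open>Shapley values as means over random coalitions\<close>

definition coalition_weight :: "nat \<Rightarrow> nat \<Rightarrow> real" where
  "coalition_weight n s = fact s * fact (n - s) / fact (n + 1)"

text \<open>The mean of \<open>f\<close> over the members of \<open>A\<close> that precede a fixed element outside \<open>A\<close> in a uniformly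
  random order.\<close>

definition coalition_mean :: "'a set \<Rightarrow> ('a set \<Rightarrow> real) \<Rightarrow> real" where
  "coalition_mean A f = (\<Sum>S\<in>Pow A. coalition_weight (card A) (card S) * f S)"

lemma coalition_weight_Suc:
  assumes "s \<le> n"
  shows "coalition_weight (Suc n) s = coalition_weight n s * ((real n + 1 - real s) / (real n + 2))"
    and "coalition_weight (Suc n) (Suc s) = coalition_weight n s * ((real s + 1) / (real n + 2))"
  using assms by (simp_all add: coalition_weight_def Suc_diff_le of_nat_diff field_simps)

lemma coalition_mean_empty [simp]: "coalition_mean {} f = f {}"
  by (simp add: coalition_mean_def coalition_weight_def)

lemma coalition_mean_cong:
  "(\<And>S. S \<subseteq> A \<Longrightarrow> f S = g S) \<Longrightarrow> coalition_mean A f = coalition_mean A g"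
  by (simp add: coalition_mean_def)

lemma coalition_mean_insert:
  assumes "finite A" "a \<notin> A"
  shows "coalition_mean (insert a A) f = coalition_mean A (\<lambda>S.
    ((real (card S) + 1) * f (insert a S) + (real (card A) + 1 - real (card S)) * f S) / (real (card A) + 2))"
proof -
  let ?w = "coalition_weight (Suc (card A))"
  let ?step = "\<lambda>S. ((real (card S) + 1) * f (insert a S) + (real (card A) + 1 - real (card S)) * f S)
    / (real (card A) + 2)"
  have "coalition_mean (insert a A) f = (\<Sum>S\<in>Pow (insert a A). ?w (card S) * f S)"
    using assms by (simp add: coalition_mean_def)
  also have "\<dots> = (\<Sum>S\<in>Pow A. ?w (card S) * f S) + (\<Sum>S\<in>insert a ` Pow A. ?w (card S) * f S)"
    unfolding Pow_insert using assms by (intro sum.union_disjoint) auto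
  also have "(\<Sum>S\<in>insert a ` Pow A. ?w (card S) * f S) = (\<Sum>S\<in>Pow A. ?w (card (insert a S)) * f (insert a S))"
    using assms by (subst sum.reindex) (auto simp: inj_on_def insert_eq_iff)
  also have "(\<Sum>S\<in>Pow A. ?w (card S) * f S) + \<dots>
      = (\<Sum>S\<in>Pow A. ?w (card S) * f S + ?w (card (insert a S)) * f (insert a S))"
    by (simp add: sum.distrib)
  also have "\<dots> = coalition_mean A ?step"
    unfolding coalition_mean_def
  proof (rule sum.cong)
    fix S assume "S \<in> Pow A"
    then have "finite S" "a \<notin> S" "card S \<le> card A"
      using assms by (auto intro: finite_subset card_mono)
    moreover have "w * (p / d) * x + w * (q / d) * y = w * ((q * y + p * x) / d)" for w p q d x y :: real
      by (simp add: add_divide_distrib distrib_left)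
    ultimately show "?w (card S) * f S + ?w (card (insert a S)) * f (insert a S)
        = coalition_weight (card A) (card S) * ?step S"
      by (simp only: card_insert_disjoint coalition_weight_Suc not_False_eq_True)
  qed simp
  finally show ?thesis .
qed

lemma coalition_mean_insert_null:
  assumes "finite A" "a \<notin> A"
  shows "coalition_mean (insert a A) (\<lambda>S. f (S - {a})) = coalition_mean A f"
  unfolding coalition_mean_insert[OF assms]
proof (rule coalition_mean_cong)
  fix S assume "S \<subseteq> A"
  then have "S - {a} = S" using assms by auto
  then show "((real (card S) + 1) * f (insert a S - {a}) + (real (card A) + 1 - real (card S)) * f (S - {a}))
      / (real (card A) + 2) = f S"
    by (simp add: distrib_right[symmetric] nonzero_divide_eq_eq)
qed

lemma coalition_mean_const: "finite A \<Longrightarrow> coalition_mean A (\<lambda>_. d) = d"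
proof (induction A rule: finite_induct)
  case (insert a A)
  then show ?case using coalition_mean_insert_null[of A a "\<lambda>_. d"] by simp
qed simp

lemma abs_coalition_mean_diff_le:
  assumes "finite A" "\<And>S. S \<subseteq> A \<Longrightarrow> \<bar>f S - g S\<bar> \<le> d"
  shows "\<bar>coalition_mean A f - coalition_mean A g\<bar> \<le> d"
proof -
  let ?w = "\<lambda>S. coalition_weight (card A) (card S)"
  have "\<bar>coalition_mean A f - coalition_mean A g\<bar> = \<bar>\<Sum>S\<in>Pow A. ?w S * (f S - g S)\<bar>"
    by (simp add: coalition_mean_def sum_subtractf right_diff_distrib)
  also have "\<dots> \<le> (\<Sum>S\<in>Pow A. \<bar>?w S * (f S - g S)\<bar>)"
    by (rule sum_abs)
  also have "\<dots> \<le> coalition_mean A (\<lambda>_. d)"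
    unfolding coalition_mean_def using assms(2)
    by (intro sum_mono) (simp add: abs_mult coalition_weight_def divide_right_mono)
  also have "\<dots> = d" using assms(1) by (rule coalition_mean_const)
  finally show ?thesis .
qed

lemma shapley_eq_coalition_mean:
  assumes "finite N" "i \<in> N"
  shows "shapley N v i = coalition_mean (N - {i}) (\<lambda>S. v (insert i S) - v S)"
proof -
  have "card N = card (N - {i}) + 1"
    using card_Suc_Diff1[OF assms] by simp
  then show ?thesis by (simp add: shapley_def coalition_mean_def coalition_weight_def)
qed

lemma shapley_mult_left: "shapley N (\<lambda>S. c * v S) i = c * shapley N v i"
  by (simp add: shapley_def sum_distrib_left right_diff_distrib[symmetric] mult.left_commute)

lemma abs_shapley_diff_le:
  assumes "finite N" "i \<in> N"
    and "\<And>S. S \<subseteq> N - {i} \<Longrightarrow> \<bar>(u (insert i S) - u S) - (v (insert i S) - v S)\<bar> \<le> d"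
  shows "\<bar>shapley N u i - shapley N v i\<bar> \<le> d"
  unfolding shapley_eq_coalition_mean[OF assms(1,2)]
  using assms by (intro abs_coalition_mean_diff_le) auto

section \<open>Knapsack values\<close>

definition feasible :: "('a \<Rightarrow> nat) \<Rightarrow> nat \<Rightarrow> 'a set \<Rightarrow> 'a set set" where
  "feasible l c S = {R. R \<subseteq> S \<and> sum l R \<le> c}"

definition knapsack :: "('a \<Rightarrow> nat) \<Rightarrow> ('a \<Rightarrow> nat) \<Rightarrow> nat \<Rightarrow> 'a set \<Rightarrow> nat" where
  "knapsack l w c S = Max (sum w ` feasible l c S)"

lemma finite_feasible [simp]: "finite S \<Longrightarrow> finite (feasible l c S)"
  by (simp add: feasible_def)

lemma feasible_nonempty [simp]: "feasible l c S \<noteq> {}"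
proof -
  have "{} \<in> feasible l c S" by (simp add: feasible_def)
  then show ?thesis by blast
qed

lemma knap_val_eq_knapsack:
  assumes "finite S"
  shows "knap_val l w c S = real (knapsack l w c S)"
proof -
  have "knap_val l w c S = Max (real ` sum w ` feasible l c S)"
    unfolding knap_val_def feasible_def by (rule arg_cong[of _ _ Max]) (auto simp del: of_nat_sum)
  also have "\<dots> = real (knapsack l w c S)"
    unfolding knapsack_def using assms by (intro mono_Max_commute[symmetric]) (auto simp: mono_def)
  finally show ?thesis .
qed

lemma knapsack_ge:
  assumes "finite S" "R \<in> feasible l c S"
  shows "sum w R \<le> knapsack l w c S"
  unfolding knapsack_def using assms by (intro Max_ge) auto

lemma knapsack_attained:
  assumes "finite S"
  obtains R where "R \<in> feasible l c S" "knapsack l w c S = sum w R"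
proof -
  have "knapsack l w c S \<in> sum w ` feasible l c S"
    unfolding knapsack_def using assms by (intro Max_in) auto
  then show ?thesis using that by auto
qed

lemma knapsack_empty [simp]: "knapsack l w c {} = 0"
  by (rule knapsack_attained[of "{}" l c w]) (auto simp: feasible_def)

lemma knapsack_capacity_mono:
  assumes "finite S" "c \<le> d"
  shows "knapsack l w c S \<le> knapsack l w d S"
proof -
  obtain R where "R \<in> feasible l c S" "knapsack l w c S = sum w R"
    using knapsack_attained[OF assms(1)] .
  then show ?thesis using assms knapsack_ge[of S R l d w] by (simp add: feasible_def)
qed

lemma feasible_insert:
  assumes "finite S" "k \<notin> S"
  shows "feasible l c (insert k S)
    = feasible l c S \<union> (if l k \<le> c then insert k ` feasible l (c - l k) S else {})"
proof -
  have "sum l (insert k R) = l k + sum l R" if "R \<subseteq> S" for R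
    using that assms by (intro sum.insert) (auto intro: finite_subset)
  moreover have "feasible l c (insert k S) = {R \<in> Pow S \<union> insert k ` Pow S. sum l R \<le> c}"
    by (auto simp: feasible_def simp flip: Pow_insert)
  ultimately show ?thesis by (auto simp: feasible_def)
qed

lemma knapsack_insert:
  assumes "finite S" "k \<notin> S"
  shows "knapsack l w c (insert k S) =
    (if l k \<le> c then max (knapsack l w c S) (knapsack l w (c - l k) S + w k) else knapsack l w c S)"
proof (cases "l k \<le> c")
  case True
  let ?F = "feasible l (c - l k) S"
  have "sum w (insert k R) = sum w R + w k" if "R \<in> ?F" for R
    using that assms by (subst sum.insert) (auto simp: feasible_def intro: finite_subset)
  then have "sum w ` feasible l c (insert k S) = sum w ` feasible l c S \<union> (\<lambda>R. sum w R + w k) ` ?F"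
    using True by (simp add: feasible_insert[OF assms] image_Un image_image)
  moreover have "Max ((\<lambda>R. sum w R + w k) ` ?F) = knapsack l w (c - l k) S + w k"
    unfolding knapsack_def using assms by (intro Max_add_commute) auto
  ultimately show ?thesis
    using True assms by (simp add: knapsack_def Max_Un)
qed (simp add: knapsack_def feasible_insert[OF assms])

lemma knapsack_cong:
  assumes "\<And>k. k \<in> S \<Longrightarrow> l k = l' k" "\<And>k. k \<in> S \<Longrightarrow> w k = w' k"
  shows "knapsack l w c S = knapsack l' w' c S"
proof -
  have "sum l R = sum l' R" "sum w R = sum w' R" if "R \<subseteq> S" for R
    using that assms by (auto intro!: sum.cong)
  then have "sum w ` feasible l c S = sum w' ` feasible l' c S"
    unfolding feasible_def by (intro image_cong) auto
  then show ?thesis unfolding knapsack_def by simp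
qed

lemma knapsack_null_item:
  assumes "finite S"
  shows "knapsack (l(i := 0)) (w(i := 0)) c S = knapsack l w c (S - {i})"
proof -
  have "knapsack (l(i := 0)) (w(i := 0)) c S = knapsack (l(i := 0)) (w(i := 0)) c (S - {i})"
    using assms knapsack_insert[of "S - {i}" i "l(i := 0)" "w(i := 0)" c]
    by (cases "i \<in> S") (simp_all add: insert_absorb)
  also have "\<dots> = knapsack l w c (S - {i})" by (rule knapsack_cong) auto
  finally show ?thesis .
qed

lemma knapsack_le_density:
  assumes "finite S" "\<And>k. k \<in> S \<Longrightarrow> real (w k) \<le> r * real (l k)" "r \<ge> 0"
  shows "real (knapsack l w c S) \<le> r * real c"
proof -
  obtain R where "R \<in> feasible l c S" and attained: "knapsack l w c S = sum w R"
    using knapsack_attained[OF assms(1)] .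
  then have R: "R \<subseteq> S" "sum l R \<le> c" by (simp_all add: feasible_def)
  have "real (sum w R) = (\<Sum>k\<in>R. real (w k))" by simp
  also have "\<dots> \<le> (\<Sum>k\<in>R. r * real (l k))"
    using R assms(2) by (intro sum_mono) auto
  also have "\<dots> = r * real (sum l R)" by (simp add: sum_distrib_left)
  also have "\<dots> \<le> r * real c" using R assms(3) by (intro mult_left_mono) (simp_all del: of_nat_sum)
  finally show ?thesis using attained by simp
qed

lemma knapsack_marginal_bounds:
  assumes "finite S" "i \<notin> S"
  shows "knapsack l w c S \<le> knapsack l w c (insert i S)"
    and "knapsack l w c (insert i S) \<le> knapsack l w c S + w i"
  using knapsack_capacity_mono[OF assms(1), of "c - l i" c l w] by (auto simp: knapsack_insert[OF assms])

section \<open>Rounding the weights\<close>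

definition rounded :: "real \<Rightarrow> ('a \<Rightarrow> nat) \<Rightarrow> 'a \<Rightarrow> nat" where
  "rounded U w k = nat \<lfloor>real (w k) / U\<rfloor>"

lemma of_int_floor_rounded: "U \<ge> 0 \<Longrightarrow> real_of_int \<lfloor>real (w k) / U\<rfloor> = real (rounded U w k)"
  by (simp add: rounded_def)

lemma rounded_null: "rounded U (w(i := 0)) = (rounded U w)(i := 0)"
  by (auto simp: rounded_def)

text \<open>A feasible set has at most \<open>c\<close> elements, each of which loses at most \<open>U\<close>.\<close>

lemma knapsack_rounding:
  assumes "finite S" "\<And>k. k \<in> S \<Longrightarrow> 0 < l k" "U \<ge> 0"
    and lower: "\<And>k. k \<in> S \<Longrightarrow> U * real (w' k) \<le> real (w k)"
    and upper: "\<And>k. k \<in> S \<Longrightarrow> real (w k) \<le> U * real (w' k) + U"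
  shows "U * real (knapsack l w' c S) \<le> real (knapsack l w c S)"
    and "real (knapsack l w c S) \<le> U * real (knapsack l w' c S) + real c * U"
proof -
  obtain R where "R \<in> feasible l c S" and attained: "knapsack l w' c S = sum w' R"
    using knapsack_attained[OF assms(1)] .
  then have "R \<subseteq> S" "sum w R \<le> knapsack l w c S"
    using assms(1) by (simp_all add: feasible_def knapsack_ge)
  have "U * real (sum w' R) = (\<Sum>k\<in>R. U * real (w' k))" by (simp add: sum_distrib_left)
  also have "\<dots> \<le> (\<Sum>k\<in>R. real (w k))" using \<open>R \<subseteq> S\<close> lower by (intro sum_mono) auto
  also have "\<dots> = real (sum w R)" by simp
  also have "\<dots> \<le> real (knapsack l w c S)" using \<open>sum w R \<le> _\<close> by (simp only: of_nat_le_iff)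
  finally show "U * real (knapsack l w' c S) \<le> real (knapsack l w c S)" by (simp only: attained)
next
  obtain R where "R \<in> feasible l c S" and attained: "knapsack l w c S = sum w R"
    using knapsack_attained[OF assms(1)] .
  then have R: "R \<subseteq> S" "sum l R \<le> c" "sum w' R \<le> knapsack l w' c S"
    using assms(1) by (simp_all add: feasible_def knapsack_ge)
  have "card R = (\<Sum>k\<in>R. 1)" by simp
  also have "\<dots> \<le> sum l R" using R(1) assms(2) by (intro sum_mono) (auto simp: Suc_le_eq)
  finally have "card R \<le> c" using R(2) by simp
  have "real (sum w R) = (\<Sum>k\<in>R. real (w k))" by simp
  also have "\<dots> \<le> (\<Sum>k\<in>R. U * real (w' k) + U)" using R(1) upper by (intro sum_mono) auto
  also have "\<dots> = U * real (sum w' R) + real (card R) * U" by (simp add: sum.distrib sum_distrib_left)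
  also have "\<dots> \<le> U * real (knapsack l w' c S) + real c * U"
    using R(3) \<open>card R \<le> c\<close> assms(3)
    by (intro add_mono mult_left_mono mult_right_mono) (simp_all del: of_nat_sum)
  finally show "real (knapsack l w c S) \<le> U * real (knapsack l w' c S) + real c * U"
    by (simp only: attained)
qed

definition max_density :: "('a \<Rightarrow> nat) \<Rightarrow> ('a \<Rightarrow> nat) \<Rightarrow> 'a set \<Rightarrow> real" where
  "max_density l w N = Max ((\<lambda>k. real (w k) / real (l k)) ` N)"

lemma weight_le_max_density:
  assumes "finite N" "k \<in> N" "0 < l k"
  shows "real (w k) \<le> max_density l w N * real (l k)"
proof -
  have "real (w k) / real (l k) \<le> max_density l w N"
    unfolding max_density_def using assms by (intro Max_ge) auto
  then show ?thesis using assms by (simp add: field_simps)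
qed

lemma max_density_nonneg:
  assumes "finite N" "N \<noteq> {}"
  shows "0 \<le> max_density l w N"
  using assms by (auto simp: max_density_def Max_ge_iff)

lemma cap_max_density_le_w_max: "real L * max_density l w {1..n} \<le> real_of_int (w_max n l w L)"
  unfolding w_max_def max_density_def by linarith

text \<open>For \<open>U = 0\<close> all rounded weights are \<open>0\<close>, because \<open>x / 0 = 0\<close>.\<close>

lemma rounded_bounds:
  assumes "U \<ge> 0" "U = 0 \<Longrightarrow> w k = 0"
  shows "U * real (rounded U w k) \<le> real (w k)" "real (w k) \<le> U * real (rounded U w k) + U"
proof -
  have "real (rounded U w k) = real_of_int \<lfloor>real (w k) / U\<rfloor>"
    by (rule of_int_floor_rounded[OF assms(1), symmetric])
  then have "real (rounded U w k) \<le> real (w k) / U" "real (w k) / U \<le> real (rounded U w k) + 1"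
    by linarith+
  then show "U * real (rounded U w k) \<le> real (w k)" "real (w k) \<le> U * real (rounded U w k) + U"
    using assms by (cases "U = 0"; simp add: field_simps)+
qed

lemma rounded_le_length:
  assumes "finite N" "k \<in> N" "0 < l k" "eps > 0"
  shows "real (rounded (eps * max_density l w N) w k) \<le> 1 / eps * real (l k)"
proof -
  let ?r = "max_density l w N"
  have "?r \<ge> 0" using assms(1,2) by (intro max_density_nonneg) auto
  then have "real (rounded (eps * ?r) w k) \<le> real (w k) / (eps * ?r)"
    using assms(4) by (simp add: rounded_def)
  also have "\<dots> \<le> ?r * real (l k) / (eps * ?r)"
    using weight_le_max_density[of N k l w] assms(1-3) \<open>?r \<ge> 0\<close> assms(4) by (intro divide_right_mono) auto
  also have "\<dots> \<le> 1 / eps * real (l k)"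
    using assms(4) by (cases "?r = 0") (simp_all add: field_simps)
  finally show ?thesis .
qed

lemma abs_shapley_knap_val_le:
  assumes "finite N" "i \<in> N"
  shows "\<bar>shapley N (knap_val l w L) i\<bar> \<le> real (w i)"
proof -
  have "\<bar>(0 - 0) - (knap_val l w L (insert i S) - knap_val l w L S)\<bar> \<le> real (w i)" if "S \<subseteq> N - {i}" for S
  proof -
    have S: "finite S" "i \<notin> S" using that assms(1) by (auto intro: finite_subset)
    show ?thesis
      using knapsack_marginal_bounds[OF S, of l w L] S(1) by (simp add: knap_val_eq_knapsack)
  qed
  then have "\<bar>shapley N (\<lambda>_. 0) i - shapley N (knap_val l w L) i\<bar> \<le> real (w i)"
    by (rule abs_shapley_diff_le[OF assms])
  then show ?thesis by (simp add: shapley_def)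
qed

lemma abs_shapley_rounding_le:
  assumes N: "finite N" "i \<in> N" and l: "\<And>k. k \<in> N \<Longrightarrow> 0 < l k" and U: "U \<ge> 0"
    and lower: "\<And>k. k \<in> N \<Longrightarrow> U * real (w' k) \<le> real (w k)"
    and upper: "\<And>k. k \<in> N \<Longrightarrow> real (w k) \<le> U * real (w' k) + U"
  shows "\<bar>U * shapley N (knap_val l w' L) i - shapley N (knap_val l w L) i\<bar> \<le> real L * U"
proof -
  let ?u = "\<lambda>S. U * knap_val l w' L S" and ?v = "knap_val l w L"
  have coalition: "?u S \<le> ?v S" "?v S \<le> ?u S + real L * U" if "S \<subseteq> N" for S
  proof -
    have "finite S" using that N(1) by (rule finite_subset)
    then show "?u S \<le> ?v S" "?v S \<le> ?u S + real L * U"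
      using knapsack_rounding[of S l U w' w L] that l U lower upper
      by (simp_all add: knap_val_eq_knapsack subset_iff)
  qed
  have "\<bar>shapley N ?u i - shapley N ?v i\<bar> \<le> real L * U"
  proof (rule abs_shapley_diff_le[OF N])
    fix S assume "S \<subseteq> N - {i}"
    then have "S \<subseteq> N" "insert i S \<subseteq> N" using N(2) by auto
    then show "\<bar>(?u (insert i S) - ?u S) - (?v (insert i S) - ?v S)\<bar> \<le> real L * U"
      using coalition[of S] coalition[of "insert i S"] by linarith
  qed
  then show ?thesis by (simp only: shapley_mult_left)
qed

lemma shapley_rounding_error:
  fixes l w :: "nat \<Rightarrow> nat"
  assumes i: "i \<in> {1..n}" and l: "\<And>k. k \<in> {1..n} \<Longrightarrow> 0 < l k" and eps: "eps > 0"
  defines "U \<equiv> eps * max_density l w {1..n}"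
  shows "\<bar>U * shapley {1..n} (knap_val l (rounded U w) L) i - shapley {1..n} (knap_val l w L) i\<bar>
    \<le> eps * real_of_int (w_max n l w L)"
proof -
  have "U \<ge> 0" using max_density_nonneg[of "{1..n}" l w] i eps by (auto simp: U_def)
  moreover have "w k = 0" if "k \<in> {1..n}" "U = 0" for k
    using weight_le_max_density[of "{1..n}" k l w] that l eps by (simp add: U_def)
  ultimately have "\<bar>U * shapley {1..n} (knap_val l (rounded U w) L) i - shapley {1..n} (knap_val l w L) i\<bar>
    \<le> real L * U"
    using i l by (intro abs_shapley_rounding_le rounded_bounds) auto
  also have "\<dots> = eps * (real L * max_density l w {1..n})" by (simp add: U_def)
  also have "\<dots> \<le> eps * real_of_int (w_max n l w L)"
    using eps by (intro mult_left_mono cap_max_density_le_w_max) simp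
  finally show ?thesis .
qed

lemma abs_shapley_le_w_max:
  assumes "i \<in> {1..n}" "0 < l i" "l i \<le> L"
  shows "\<bar>shapley {1..n} (knap_val l w L) i\<bar> \<le> real_of_int (w_max n l w L)"
proof -
  let ?r = "max_density l w {1..n}"
  have "\<bar>shapley {1..n} (knap_val l w L) i\<bar> \<le> real (w i)"
    using assms(1) by (intro abs_shapley_knap_val_le) auto
  also have "\<dots> \<le> ?r * real (l i)" using assms by (intro weight_le_max_density) auto
  also have "\<dots> \<le> ?r * real L" using assms by (intro mult_left_mono max_density_nonneg) auto
  also have "\<dots> \<le> real_of_int (w_max n l w L)"
    using cap_max_density_le_w_max[of L l w n] by (simp only: mult.commute)
  finally show ?thesis .
qed

section \<open>Encoding tables and coalition sizes\<close>

definition digit :: "nat \<Rightarrow> nat \<Rightarrow> nat \<Rightarrow> nat" where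
  "digit b x c = x div b ^ c mod b"

definition encode :: "nat \<Rightarrow> nat \<Rightarrow> (nat \<Rightarrow> nat) \<Rightarrow> nat \<Rightarrow> nat" where
  "encode b L T s = (\<Sum>c\<le>L. T c * b ^ c) + s * b ^ (L + 1)"

lemma sum_digits_Suc:
  fixes T :: "nat \<Rightarrow> nat"
  shows "(\<Sum>j<Suc k. T j * b ^ j) = T 0 + b * (\<Sum>j<k. T (Suc j) * b ^ j)"
  unfolding sum.lessThan_Suc_shift by (simp add: sum_distrib_left mult.left_commute)

lemma sum_digits_div:
  fixes T :: "nat \<Rightarrow> nat"
  assumes "\<And>j. j < c \<Longrightarrow> T j < b" "c \<le> k"
  shows "(\<Sum>j<k. T j * b ^ j) div b ^ c = (\<Sum>j<k - c. T (c + j) * b ^ j)"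
  using assms
proof (induction c arbitrary: T k)
  case (Suc c)
  then obtain k' where k: "k = Suc k'" "c \<le> k'" by (cases k) auto
  have "(\<Sum>j<k. T j * b ^ j) div b = (\<Sum>j<k'. T (Suc j) * b ^ j)"
    using Suc.prems(1)[of 0] by (simp add: k(1) sum_digits_Suc del: sum.lessThan_Suc)
  then show ?case
    using Suc.IH[of "\<lambda>j. T (Suc j)" k'] Suc.prems(1) k by (simp add: div_mult2_eq)
qed simp

lemma encode_div_power:
  assumes "\<And>c. c \<le> L \<Longrightarrow> T c < b" "c \<le> L + 1"
  shows "encode b L T s div b ^ c = (\<Sum>j<L + 2 - c. (T(L + 1 := s)) (c + j) * b ^ j)"
proof -
  have "encode b L T s = (\<Sum>j<L + 2. (T(L + 1 := s)) j * b ^ j)"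
    by (simp add: encode_def lessThan_Suc_atMost)
  then show ?thesis
    using assms sum_digits_div[of c "T(L + 1 := s)" b "L + 2"] by simp
qed

lemma encode_div_block:
  assumes "\<And>c. c \<le> L \<Longrightarrow> T c < b"
  shows "encode b L T s div b ^ (L + 1) = s"
  using assms by (subst encode_div_power) (auto simp: lessThan_Suc)

lemma encode_less:
  assumes "\<And>c. c \<le> L \<Longrightarrow> T c < b" "s \<le> n"
  shows "encode b L T s < (n + 1) * b ^ (L + 1)"
proof -
  have "encode b L T s div b ^ (L + 1) < n + 1"
    using encode_div_block[of L T b s, OF assms(1)] assms(2) by simp
  moreover have "b > 0" using assms(1)[of 0] by simp
  ultimately show ?thesis by (simp only: div_less_iff_less_mult zero_less_power)
qed

lemma digit_encode:
  assumes "\<And>c. c \<le> L \<Longrightarrow> T c < b" "c \<le> L"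
  shows "digit b (encode b L T s) c = T c"
proof -
  let ?T = "T(L + 1 := s)"
  have "encode b L T s div b ^ c = (\<Sum>j<Suc (L + 1 - c). ?T (c + j) * b ^ j)"
    using assms by (subst encode_div_power)
      (simp_all only: Suc_diff_le le_SucI add_2_eq_Suc' Suc_eq_plus1[symmetric] add_Suc_right)
  also have "\<dots> mod b = T c"
    using assms by (simp add: sum_digits_Suc del: sum.lessThan_Suc)
  finally show ?thesis by (simp add: digit_def)
qed

text \<open>The amount by which an item of length \<open>l\<close> and weight \<open>w\<close> raises the entry \<open>l + c\<close> of the table
  encoded by \<open>x\<close>; the subtraction is truncated.\<close>

definition gain :: "nat \<Rightarrow> nat \<Rightarrow> nat \<Rightarrow> nat \<Rightarrow> nat \<Rightarrow> nat" where
  "gain b l w x c = digit b x c + w - digit b x (l + c)"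

definition next_state :: "nat \<Rightarrow> nat \<Rightarrow> nat \<Rightarrow> nat \<Rightarrow> nat \<Rightarrow> nat" where
  "next_state b L l w x = x + b ^ (L + 1) + (\<Sum>c\<le>L - l. gain b l w x c * b ^ (l + c))"

lemma next_state_encode:
  assumes T: "\<And>c. c \<le> L \<Longrightarrow> T c < b" and l: "l \<le> L"
  shows "next_state b L l w (encode b L T s)
    = encode b L (\<lambda>c. if l \<le> c then max (T c) (T (c - l) + w) else T c) (Suc s)"
proof -
  have "(\<Sum>c\<le>L - l. gain b l w (encode b L T s) c * b ^ (l + c))
      = (\<Sum>c\<le>L - l. (T c + w - T (l + c)) * b ^ (l + c))"
    using l by (intro sum.cong) (auto simp: gain_def digit_encode T)
  also have "\<dots> = (\<Sum>c\<in>{l..L}. (T (c - l) + w - T c) * b ^ c)"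
    by (rule sum.reindex_bij_witness[of _ "\<lambda>c. c - l" "\<lambda>c. l + c"]) (use l in auto)
  also have "\<dots> = (\<Sum>c\<le>L. (if l \<le> c then T (c - l) + w - T c else 0) * b ^ c)"
    by (rule sum.mono_neutral_cong_left) auto
  finally have "next_state b L l w (encode b L T s) = (\<Sum>c\<le>L. T c * b ^ c)
      + (\<Sum>c\<le>L. (if l \<le> c then T (c - l) + w - T c else 0) * b ^ c) + Suc s * b ^ (L + 1)"
    by (simp add: next_state_def encode_def)
  also have "(\<Sum>c\<le>L. T c * b ^ c) + (\<Sum>c\<le>L. (if l \<le> c then T (c - l) + w - T c else 0) * b ^ c)
      = (\<Sum>c\<le>L. (if l \<le> c then max (T c) (T (c - l) + w) else T c) * b ^ c)"
    unfolding sum.distrib[symmetric] add_mult_distrib[symmetric] by (intro sum.cong) auto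
  finally show ?thesis by (simp only: encode_def)
qed

definition coalition_state :: "nat \<Rightarrow> nat \<Rightarrow> ('a \<Rightarrow> nat) \<Rightarrow> ('a \<Rightarrow> nat) \<Rightarrow> 'a set \<Rightarrow> nat" where
  "coalition_state b L l w S = encode b L (\<lambda>c. knapsack l w c S) (card S)"

definition tables_below :: "nat \<Rightarrow> nat \<Rightarrow> ('a \<Rightarrow> nat) \<Rightarrow> ('a \<Rightarrow> nat) \<Rightarrow> 'a set \<Rightarrow> bool" where
  "tables_below b L l w N \<longleftrightarrow> (\<forall>S\<subseteq>N. \<forall>c\<le>L. knapsack l w c S < b)"

lemma coalition_state_empty [simp]: "coalition_state b L l w {} = 0"
  by (simp add: coalition_state_def encode_def)

lemma coalition_state_div_block:
  assumes "tables_below b L l w N" "S \<subseteq> N"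
  shows "coalition_state b L l w S div b ^ (L + 1) = card S"
  unfolding coalition_state_def using assms by (intro encode_div_block) (simp add: tables_below_def)

lemma coalition_state_less:
  assumes "tables_below b L l w N" "S \<subseteq> N" "card S \<le> n"
  shows "coalition_state b L l w S < (n + 1) * b ^ (L + 1)"
  unfolding coalition_state_def using assms by (intro encode_less) (simp_all add: tables_below_def)

lemma next_state_coalition_state:
  assumes "tables_below b L l w N" "S \<subseteq> N" "finite S" "k \<notin> S" "l k \<le> L"
  shows "next_state b L (l k) (w k) (coalition_state b L l w S) = coalition_state b L l w (insert k S)"
proof -
  have "next_state b L (l k) (w k) (coalition_state b L l w S) = encode b L (\<lambda>c. if l k \<le> c
      then max (knapsack l w c S) (knapsack l w (c - l k) S + w k) else knapsack l w c S) (Suc (card S))"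
    unfolding coalition_state_def using assms by (intro next_state_encode) (simp_all add: tables_below_def)
  then show ?thesis
    using assms by (simp add: coalition_state_def knapsack_insert)
qed

lemma gain_encode_knapsack:
  assumes "tables_below b L l w N" "S \<subseteq> N" "finite S" "i \<notin> S" "l i \<le> L"
  shows "real (gain b (l i) (w i) (encode b L (\<lambda>c. knapsack l w c S) s) (L - l i))
    = real (knapsack l w L (insert i S)) - real (knapsack l w L S)"
proof -
  have "knapsack l w c S < b" if "c \<le> L" for c
    using assms that by (simp add: tables_below_def)
  then have "gain b (l i) (w i) (encode b L (\<lambda>c. knapsack l w c S) s) (L - l i)
      = knapsack l w (L - l i) S + w i - knapsack l w L S"
    using assms(5) by (simp add: gain_def digit_encode)
  then show ?thesis using assms(3-5) by (simp add: knapsack_insert max_def)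
qed

lemma tables_below_null_item:
  assumes "finite N" "tables_below b L l w N"
  shows "tables_below b L (l(i := 0)) (w(i := 0)) N"
  unfolding tables_below_def
proof (intro allI impI)
  fix S c assume "S \<subseteq> N" "c \<le> L"
  then have "finite S" "S - {i} \<subseteq> N" using assms(1) by (auto intro: finite_subset)
  then show "knapsack (l(i := 0)) (w(i := 0)) c S < b"
    using assms(2) \<open>c \<le> L\<close> by (simp add: knapsack_null_item tables_below_def)
qed

lemma coalition_mean_gain_eq_shapley:
  assumes N: "finite N" "i \<in> N" and below: "tables_below b L l w N" and i: "l i \<le> L"
  shows "coalition_mean N (\<lambda>S. real (gain b (l i) (w i)
      (coalition_state b L (l(i := 0)) (w(i := 0)) S) (L - l i))) = shapley N (knap_val l w L) i"
proof -
  let ?gain = "\<lambda>S. real (gain b (l i) (w i) (coalition_state b L (l(i := 0)) (w(i := 0)) S) (L - l i))"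
  let ?marginal = "\<lambda>S. real (knapsack l w L (insert i S)) - real (knapsack l w L S)"
  have "coalition_mean N ?gain = coalition_mean N (\<lambda>S. ?marginal (S - {i}))"
  proof (rule coalition_mean_cong)
    fix S assume "S \<subseteq> N"
    then have S: "finite S" "S - {i} \<subseteq> N" using N(1) by (auto intro: finite_subset)
    then have "?gain S
      = real (gain b (l i) (w i) (encode b L (\<lambda>c. knapsack l w c (S - {i})) (card S)) (L - l i))"
      by (simp add: coalition_state_def knapsack_null_item)
    then show "?gain S = ?marginal (S - {i})"
      using gain_encode_knapsack[OF below S(2)] S(1) i by simp
  qed
  also have "\<dots> = coalition_mean (insert i (N - {i})) (\<lambda>S. ?marginal (S - {i}))"
    using N(2) by (simp add: insert_absorb)
  also have "\<dots> = coalition_mean (N - {i}) ?marginal"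
    using N(1) by (intro coalition_mean_insert_null) auto
  also have "\<dots> = shapley N (knap_val l w L) i"
    unfolding shapley_eq_coalition_mean[OF N]
    using N by (intro coalition_mean_cong) (simp add: knap_val_eq_knapsack finite_subset[of _ "N - {i}"])
  finally show ?thesis .
qed

lemma tables_below_rounded:
  assumes "finite N" "\<And>k. k \<in> N \<Longrightarrow> 0 < l k" "eps > 0"
  shows "tables_below (nat \<lfloor>real L / eps\<rfloor> + 1) L l (rounded (eps * max_density l w N) w) N"
  unfolding tables_below_def
proof (intro allI impI)
  fix S c assume S: "S \<subseteq> N" and c: "c \<le> L"
  have "finite S" using S assms(1) by (rule finite_subset)
  then have "real (knapsack l (rounded (eps * max_density l w N) w) c S) \<le> 1 / eps * real c"
    using S assms by (intro knapsack_le_density rounded_le_length) auto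
  also have "\<dots> \<le> real L / eps" using c assms(3) by (simp add: divide_right_mono)
  also have "\<dots> < real (nat \<lfloor>real L / eps\<rfloor> + 1)" using assms(3) by simp linarith
  finally show "knapsack l (rounded (eps * max_density l w N) w) c S < nat \<lfloor>real L / eps\<rfloor> + 1" by simp
qed

section \<open>Execution within a time bound\<close>

definition exec_within :: "com \<Rightarrow> mem \<Rightarrow> nat \<Rightarrow> mem \<Rightarrow> bool" where
  "exec_within c m T m' \<longleftrightarrow> (\<exists>t\<le>T. exec c m t m')"

notation Seq (infixl ";;" 60)

lemma exec_within_mono: "exec_within c m T m' \<Longrightarrow> T \<le> T' \<Longrightarrow> exec_within c m T' m'"
  unfolding exec_within_def using order_trans by blast

lemma exec_within_Skip: "exec_within SKIP m 0 m"
  unfolding exec_within_def using exec.Skip by blast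

lemma exec_within_Seq [trans]:
  assumes "exec_within c1 m T1 m1" "exec_within c2 m1 T2 m2"
  shows "exec_within (c1 ;; c2) m (T1 + T2) m2"
proof -
  obtain t1 t2 where "exec c1 m t1 m1" "t1 \<le> T1" "exec c2 m1 t2 m2" "t2 \<le> T2"
    using assms unfolding exec_within_def by blast
  then have "exec (c1 ;; c2) m (t1 + t2) m2" "t1 + t2 \<le> T1 + T2"
    by (auto intro: exec.Seq)
  then show ?thesis unfolding exec_within_def by blast
qed

lemma exec_within_IfPos:
  assumes "m a > 0 \<Longrightarrow> exec_within c1 m T m'" "\<not> m a > 0 \<Longrightarrow> exec_within c2 m T m'"
  shows "exec_within (IfPos a c1 c2) m (Suc T) m'"
  using assms unfolding exec_within_def
  by (cases "m a > 0") (blast intro: exec.IfT exec.IfF Suc_le_mono[THEN iffD2])+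

lemma exec_within_countdown:
  assumes "I N m" "m a = real N"
    and step: "\<And>j m. j < N \<Longrightarrow> I (Suc j) m \<Longrightarrow> m a = real (Suc j)
      \<Longrightarrow> \<exists>m'. exec_within c m T m' \<and> I j m' \<and> m' a = real j"
  obtains m' where "exec_within (WhilePos a c) m (N * Suc T + 1) m'" "I 0 m'"
proof -
  have "\<exists>m'. exec_within (WhilePos a c) m (j * Suc T + 1) m' \<and> I 0 m'"
    if "j \<le> N" "I j m" "m a = real j" for j m
    using that
  proof (induction j arbitrary: m)
    case 0
    then have "exec (WhilePos a c) m 1 m" by (intro exec.WhileF) simp
    then show ?case using 0 unfolding exec_within_def by auto
  next
    case (Suc j)
    then obtain t1 m1 where body: "exec c m t1 m1" "t1 \<le> T" "I j m1" "m1 a = real j"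
      using step[of j m] unfolding exec_within_def by auto
    then obtain t2 m2 where rest: "exec (WhilePos a c) m1 t2 m2" "t2 \<le> j * Suc T + 1" "I 0 m2"
      using Suc.IH[of m1] Suc.prems(1) unfolding exec_within_def by auto
    have "exec (WhilePos a c) m (Suc (t1 + t2)) m2"
      using Suc.prems(3) by (intro exec.WhileT[OF _ body(1) rest(1)]) simp
    moreover have "Suc (t1 + t2) \<le> Suc j * Suc T + 1" using body(2) rest(2) by simp
    ultimately show ?case using rest(3) unfolding exec_within_def by blast
  qed
  then show ?thesis using assms(1,2) that by blast
qed

lemma exec_within_countup:
  assumes "I 0 m" "m a = real N"
    and step: "\<And>z m. z < N \<Longrightarrow> I z m \<Longrightarrow> m a = real (N - z)
      \<Longrightarrow> \<exists>m'. exec_within c m T m' \<and> I (Suc z) m' \<and> m' a = real (N - Suc z)"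
  obtains m' where "exec_within (WhilePos a c) m (N * Suc T + 1) m'" "I N m'"
proof (rule exec_within_countdown[where I = "\<lambda>j. I (N - j)" and a = a and m = m and N = N and c = c and T = T,
    OF _ assms(2)])
  fix j m assume "j < N" "I (N - Suc j) m" "m a = real (Suc j)"
  moreover from \<open>j < N\<close> have "N - (N - Suc j) = Suc j" "Suc (N - Suc j) = N - j" "N - (N - j) = j"
    by simp_all
  ultimately show "\<exists>m'. exec_within c m T m' \<and> I (N - j) m' \<and> m' a = real j"
    using step[of "N - Suc j" m] by simp
qed (use assms(1) that in simp_all)

fun basic :: "com \<Rightarrow> bool" where
  "basic (SetConst a c) = True"
| "basic (SetOp a f b c) = True"
| "basic (SetFloor a b) = True"
| "basic (LoadInd a b) = True"
| "basic (StoreInd a b) = True"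
| "basic _ = False"

fun step :: "com \<Rightarrow> mem \<Rightarrow> mem" where
  "step (SetConst a c) m = m(a := real_of_int c)"
| "step (SetOp a f b c) m = m(a := apply_op f (m b) (m c))"
| "step (SetFloor a b) m = m(a := real_of_int \<lfloor>m b\<rfloor>)"
| "step (LoadInd a b) m = m(a := m (nat \<lfloor>m b\<rfloor>))"
| "step (StoreInd a b) m = m(nat \<lfloor>m a\<rfloor> := m b)"
| "step _ m = m"

definition straight :: "com list \<Rightarrow> com" where
  "straight cs = foldr Seq cs SKIP"

lemma exec_step: "basic c \<Longrightarrow> exec c m 1 (step c m)"
  by (cases c) (auto simp del: One_nat_def intro: exec.intros)

lemma exec_within_straight:
  assumes "list_all basic cs" "length cs \<le> T"
  shows "exec_within (straight cs) m T (fold step cs m)"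
proof -
  have "exec_within (straight cs) m (length cs) (fold step cs m)"
    using assms(1)
  proof (induction cs arbitrary: m)
    case (Cons c cs)
    then have "exec_within c m 1 (step c m)" using exec_step unfolding exec_within_def by auto
    then have "exec_within (c ;; straight cs) m (1 + length cs) (fold step cs (step c m))"
      using Cons by (intro exec_within_Seq) auto
    then show ?case by (simp add: straight_def)
  qed (simp add: exec_within_Skip straight_def)
  then show ?thesis using assms(2) by (rule exec_within_mono)
qed

definition agree_outside :: "nat set \<Rightarrow> mem \<Rightarrow> mem \<Rightarrow> bool" where
  "agree_outside A m m' \<longleftrightarrow> (\<forall>a. a \<notin> A \<longrightarrow> m' a = m a)"

lemma agree_outside_trans:
  assumes "agree_outside A m m1" "agree_outside A' m1 m2" "A \<union> A' \<subseteq> B"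
  shows "agree_outside B m m2"
  using assms unfolding agree_outside_def by (metis UnCI subsetD)

section \<open>The program\<close>

abbreviation (input) r_n :: nat where "r_n \<equiv> 0"
abbreviation (input) r_cap :: nat where "r_cap \<equiv> 1"
abbreviation (input) r_agent :: nat where "r_agent \<equiv> 2"
abbreviation (input) r_eps :: nat where "r_eps \<equiv> 3"
abbreviation (input) r_one :: nat where "r_one \<equiv> 4"
abbreviation (input) r_base :: nat where "r_base \<equiv> 5"
abbreviation (input) r_block :: nat where "r_block \<equiv> 6"
abbreviation (input) r_unit :: nat where "r_unit \<equiv> 7"
abbreviation (input) r_table :: nat where "r_table \<equiv> 8"
abbreviation (input) r_saved :: nat where "r_saved \<equiv> 9"
abbreviation (input) r_item :: nat where "r_item \<equiv> 10"
abbreviation (input) r_addr :: nat where "r_addr \<equiv> 11"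
abbreviation (input) r_len :: nat where "r_len \<equiv> 12"
abbreviation (input) r_weight :: nat where "r_weight \<equiv> 13"
abbreviation (input) r_mix :: nat where "r_mix \<equiv> 14"
abbreviation (input) r_new :: nat where "r_new \<equiv> 15"
abbreviation (input) r_x :: nat where "r_x \<equiv> 16"
abbreviation (input) r_left :: nat where "r_left \<equiv> 17"
abbreviation (input) r_pow :: nat where "r_pow \<equiv> 18"
abbreviation (input) r_next :: nat where "r_next \<equiv> 19"
abbreviation (input) r_hi :: nat where "r_hi \<equiv> 20"
abbreviation (input) r_lo :: nat where "r_lo \<equiv> 21"
abbreviation (input) r_place :: nat where "r_place \<equiv> 22"
abbreviation (input) r_count :: nat where "r_count \<equiv> 23"
abbreviation (input) r_gain :: nat where "r_gain \<equiv> 24"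
abbreviation (input) r_digit :: nat where "r_digit \<equiv> 25"
abbreviation (input) r_cell :: nat where "r_cell \<equiv> 26"
abbreviation (input) r_old :: nat where "r_old \<equiv> 27"
abbreviation (input) r_size :: nat where "r_size \<equiv> 28"
abbreviation (input) r_ratio :: nat where "r_ratio \<equiv> 29"
abbreviation (input) r_zero :: nat where "r_zero \<equiv> 30"
abbreviation (input) r_tmp :: nat where "r_tmp \<equiv> 31"

abbreviation (input) load_regs :: "nat set" where "load_regs \<equiv> {r_addr, r_len, r_weight, r_tmp}"
abbreviation (input) unit_regs :: "nat set" where "unit_regs \<equiv> {r_unit} \<union> {r_item..r_weight} \<union> {r_ratio, r_tmp}"
abbreviation (input) digit_regs :: "nat set" where "digit_regs \<equiv> {r_next..r_digit} \<union> {r_tmp}"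
abbreviation (input) pass_regs :: "nat set" where "pass_regs \<equiv> {r_x, r_left} \<union> {r_next..r_tmp}"

abbreviation (input) copy :: "nat \<Rightarrow> nat \<Rightarrow> com" where
  "copy a b \<equiv> SetOp a Mul b r_one"

definition set_power :: com where
  "set_power = straight [copy r_pow r_one] ;;
     WhilePos r_count (straight [SetOp r_pow Mul r_pow r_base, SetOp r_count Sub r_count r_one])"

definition pop_digit :: "nat \<Rightarrow> nat \<Rightarrow> com list" where
  "pop_digit q d = [SetOp r_tmp Dvd q r_base, SetFloor r_tmp r_tmp,
     SetOp d Mul r_tmp r_base, SetOp d Sub q d, copy q r_tmp]"

definition raise_entry :: "com list" where
  "raise_entry = [SetOp r_tmp Mul r_gain r_place, SetOp r_next Add r_next r_tmp,
     SetOp r_place Mul r_place r_base, SetOp r_count Sub r_count r_one]"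

text \<open>At capacity \<open>l + c\<close>, \<open>r_hi\<close> contains \<open>x div b ^ (l + c)\<close>, \<open>r_lo\<close> contains \<open>x div b ^ c\<close> and
  \<open>r_place\<close> contains \<open>b ^ (l + c)\<close>. After the last capacity \<open>l\<^sub>b\<^sub>i\<^sub>n\<close>, \<open>r_gain\<close> is left with the marginal
  contribution of the current item.\<close>

definition digit_body :: com where
  "digit_body = straight (pop_digit r_hi r_digit @ pop_digit r_lo r_gain @
       [SetOp r_gain Add r_gain r_weight, SetOp r_gain Sub r_gain r_digit]) ;;
     IfPos r_gain SKIP (straight [SetConst r_gain 0]) ;;
     straight raise_entry"

definition enter_state :: "com list" where
  "enter_state = [SetOp r_next Add r_x r_block, SetOp r_hi Dvd r_x r_pow, SetFloor r_hi r_hi,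
     copy r_lo r_x, copy r_place r_pow, SetOp r_count Sub r_cap r_len, SetOp r_count Add r_count r_one]"

definition update_cell :: "com list" where
  "update_cell = [SetOp r_next Add r_next r_table, LoadInd r_next r_next,
     SetOp r_cell Add r_x r_table, LoadInd r_old r_cell,
     SetOp r_size Dvd r_x r_block, SetFloor r_size r_size,
     SetOp r_tmp Add r_size r_one, SetOp r_next Mul r_next r_tmp,
     SetOp r_tmp Sub r_item r_size, SetOp r_old Mul r_old r_tmp,
     SetOp r_next Add r_next r_old, SetOp r_next Mul r_next r_mix,
     SetOp r_gain Mul r_gain r_new, SetOp r_next Add r_next r_gain,
     StoreInd r_cell r_next, SetOp r_x Add r_x r_one, SetOp r_left Sub r_left r_one]"

definition scan_state :: com where
  "scan_state = straight enter_state ;; WhilePos r_count digit_body"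

definition pass_body :: com where
  "pass_body = scan_state ;; straight update_cell"

definition table_pass :: com where
  "table_pass = straight [copy r_count r_len] ;; set_power ;;
     straight [SetConst r_x 0, SetOp r_left Add r_n r_one, SetOp r_left Mul r_left r_block] ;;
     WhilePos r_left pass_body"

definition load_item :: com where
  "load_item = straight [SetOp r_addr Add r_item r_item, SetConst r_tmp 2, SetOp r_addr Add r_addr r_tmp,
       SetConst r_tmp 32, SetOp r_tmp Sub r_tmp r_addr] ;;
     IfPos r_tmp (straight [SetOp r_addr Add r_addr r_saved]) SKIP ;;
     straight [LoadInd r_len r_addr, SetOp r_tmp Add r_addr r_one, LoadInd r_weight r_tmp]"

definition density_body :: com where
  "density_body = load_item ;; straight [SetOp r_ratio Dvd r_weight r_len, SetOp r_tmp Sub r_ratio r_unit] ;;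
     IfPos r_tmp (straight [copy r_unit r_ratio]) SKIP ;; straight [SetOp r_item Sub r_item r_one]"

definition set_unit :: com where
  "set_unit = straight [SetConst r_unit 0, copy r_item r_n] ;; WhilePos r_item density_body ;;
     straight [SetOp r_unit Mul r_unit r_eps]"

definition set_base :: com where
  "set_base = straight [SetOp r_base Dvd r_cap r_eps, SetFloor r_base r_base, SetOp r_base Add r_base r_one,
       SetOp r_count Add r_cap r_one] ;; set_power ;; straight [copy r_block r_pow]"

definition round_weight :: "com list" where
  "round_weight = [SetOp r_weight Dvd r_weight r_unit, SetFloor r_weight r_weight]"

text \<open>A pass replaces \<open>F x\<close> by \<open>r_mix\<close> times the sum in the recursion plus \<open>r_new\<close> times the marginal
  contribution, so that the same code initialises \<open>F\<close> and performs the steps of the recursion.\<close>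

definition prepare_agent :: "com list" where
  "prepare_agent = [SetConst r_zero 0, StoreInd r_addr r_zero, StoreInd r_tmp r_zero] @ round_weight
     @ [SetConst r_mix 0, SetConst r_new 1]"

definition prepare_item :: "com list" where
  "prepare_item = round_weight
     @ [SetConst r_new 0, SetOp r_mix Add r_item r_one, SetOp r_mix Dvd r_one r_mix]"

definition set_marginals :: com where
  "set_marginals = straight [copy r_item r_agent] ;; load_item ;; straight prepare_agent ;; table_pass"

definition add_item :: com where
  "add_item = load_item ;; straight prepare_item ;; table_pass ;; straight [SetOp r_item Sub r_item r_one]"

definition fold_items :: com where
  "fold_items = straight [copy r_item r_n] ;; WhilePos r_item add_item"

definition set_parameters :: com where
  "set_parameters = set_base ;; set_unit"

definition average_marginals :: com where
  "average_marginals = set_marginals ;; fold_items"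

definition rounded_shapley :: com where
  "rounded_shapley = set_parameters ;; average_marginals ;;
    straight [LoadInd r_n r_table, SetOp r_n Mul r_n r_unit]"

text \<open>The input occupies all cells from 4 on and leaves no free register, so the address \<open>32 n\<close>, to
  which the cells below 32 are moved, is computed inside cell 0 by doubling.\<close>

definition save_cell :: "nat \<Rightarrow> com list" where
  "save_cell j = [StoreInd r_n (4 + j), SetConst r_one 1, SetOp r_n Add r_n r_one]"

definition evacuate :: "com list" where
  "evacuate = replicate 5 (SetOp r_n Add r_n r_n) @ concat (map save_cell [0..<28])"

definition set_addresses :: "com list" where
  "set_addresses = [SetConst r_tmp 28, SetOp r_n Sub r_n r_tmp, SetOp r_table Add r_n r_n, SetConst r_tmp 4,
     SetOp r_saved Sub r_n r_tmp, SetConst r_tmp 32, SetOp r_n Dvd r_n r_tmp, SetOp r_tmp Sub r_one r_eps]"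

definition approx_shapley :: com where
  "approx_shapley = straight evacuate ;; straight set_addresses ;;
    IfPos r_tmp rounded_shapley (straight [SetConst r_n 0])"

section \<open>Correctness of the table update\<close>

definition configured :: "nat \<Rightarrow> nat \<Rightarrow> nat \<Rightarrow> real \<Rightarrow> mem \<Rightarrow> bool" where
  "configured n L b U m \<longleftrightarrow> m r_n = real n \<and> m r_cap = real L \<and> m r_one = 1 \<and> m r_base = real b
     \<and> m r_block = real (b ^ (L + 1)) \<and> m r_unit = U \<and> m r_table = real (64 * n)
     \<and> m r_saved = 32 * real n - 4"

lemma configured_frame:
  assumes "configured n L b U m" "agree_outside A m m'" "A \<subseteq> {10..}"
  shows "configured n L b U m'"
proof -
  have "m' a = m a" if "a < 10" for a
    using assms(2,3) that unfolding agree_outside_def by force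
  then show ?thesis using assms(1) by (simp add: configured_def)
qed

lemma set_power_correct:
  assumes "m r_one = 1" "m r_base = real b" "m r_count = real j"
  obtains m' where "exec_within set_power m (3 * j + 2) m'" "agree_outside {r_pow, r_count} m m'"
    "m' r_pow = real (b ^ j)"
proof -
  let ?body = "[SetOp r_pow Mul r_pow r_base, SetOp r_count Sub r_count r_one]"
  define m1 where "m1 = fold step [copy r_pow r_one] m"
  have init: "exec_within (straight [copy r_pow r_one]) m 1 m1"
    unfolding m1_def by (rule exec_within_straight) simp_all
  define I where "I z m' \<longleftrightarrow> agree_outside {r_pow, r_count} m m' \<and> m' r_pow = real (b ^ z)" for z m'
  obtain m' where loop: "exec_within (WhilePos r_count (straight ?body)) m1 (j * Suc 2 + 1) m'" and "I j m'"
  proof (rule exec_within_countup[where I = I and m = m1])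
    fix z m2 assume "z < j" "I z m2" "m2 r_count = real (j - z)"
    then have "I (Suc z) (fold step ?body m2)" "fold step ?body m2 r_count = real (j - Suc z)"
      using assms by (auto simp: I_def agree_outside_def)
    moreover have "exec_within (straight ?body) m2 2 (fold step ?body m2)"
      by (rule exec_within_straight) simp_all
    ultimately show "\<exists>m'. exec_within (straight ?body) m2 2 m' \<and> I (Suc z) m' \<and> m' r_count = real (j - Suc z)"
      by blast
  qed (use assms in \<open>auto simp: I_def agree_outside_def m1_def\<close>)
  note init also note loop
  finally have "exec_within set_power m (3 * j + 2) m'"
    unfolding set_power_def by (rule exec_within_mono) simp
  then show ?thesis using \<open>I j m'\<close> by (intro that[of m']) (simp_all add: I_def)
qed

lemma fold_pop_digit:
  assumes "m r_one = 1" "m r_base = real b" "m q = real x" "q \<noteq> d"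
    and "q \<notin> {r_one, r_base, r_tmp}" "d \<notin> {r_one, r_base, r_tmp}"
  shows "fold step (pop_digit q d) m = m(r_tmp := real (x div b), d := real (x mod b), q := real (x div b))"
proof -
  have "real x - real (x div b) * real b = real (x mod b)"
    by (simp only: of_nat_diff[symmetric] of_nat_mult[symmetric] div_times_less_eq_dividend
      minus_div_mult_eq_mod)
  then show ?thesis
    using assms by (auto simp: pop_digit_def floor_divide_of_nat_eq)
qed

lemma digit_body_correct:
  assumes "m r_one = 1" "m r_base = real b" "m r_weight = real w" "m r_next = real y"
    "m r_hi = real X" "m r_lo = real Y" "m r_place = real p" "m r_count = real (Suc r)"
  defines "g \<equiv> Y mod b + w - X mod b"
  obtains m' where "exec_within digit_body m 18 m'" "agree_outside digit_regs m m'"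
    "m' r_next = real (y + g * p)" "m' r_hi = real (X div b)" "m' r_lo = real (Y div b)"
    "m' r_place = real (p * b)" "m' r_count = real r" "m' r_gain = real g"
proof -
  let ?prep = "pop_digit r_hi r_digit @ pop_digit r_lo r_gain @
    [SetOp r_gain Add r_gain r_weight, SetOp r_gain Sub r_gain r_digit]"
  define m1 where "m1 = fold step ?prep m"
  define m2 where "m2 = m1(r_gain := real g)"
  define m3 where "m3 = fold step raise_entry m2"
  have m1: "m1 = m(r_tmp := real (Y div b), r_digit := real (X mod b), r_hi := real (X div b),
      r_lo := real (Y div b), r_gain := real (Y mod b) + real w - real (X mod b))"
    using assms by (simp add: m1_def fold_pop_digit[of _ b _ X] fold_pop_digit[of _ b _ Y] fun_upd_twist)
  have prep: "exec_within (straight ?prep) m 12 m1"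
    unfolding m1_def by (rule exec_within_straight) (simp_all add: pop_digit_def)
  have clamp: "exec_within (IfPos r_gain SKIP (straight [SetConst r_gain 0])) m1 (Suc 1) m2"
  proof (rule exec_within_IfPos)
    assume "m1 r_gain > 0"
    then have "m2 = m1" by (auto simp: m1 m2_def g_def of_nat_diff)
    then show "exec_within SKIP m1 1 m2" using exec_within_mono[OF exec_within_Skip] by simp
  next
    assume "\<not> m1 r_gain > 0"
    then have "m2 = m1(r_gain := 0)" by (auto simp: m1 m2_def g_def)
    then show "exec_within (straight [SetConst r_gain 0]) m1 1 m2"
      using exec_within_straight[of "[SetConst r_gain 0]" 1 m1] by simp
  qed
  have raise: "exec_within (straight raise_entry) m2 4 m3"
    unfolding m3_def by (rule exec_within_straight) (simp_all add: raise_entry_def)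
  note prep also note clamp also note raise
  finally have "exec_within digit_body m 18 m3"
    unfolding digit_body_def by (rule exec_within_mono) simp
  then show ?thesis
    by (rule that) (use assms(1-8) in \<open>auto simp: m1 m2_def m3_def raise_entry_def agree_outside_def\<close>)
qed

lemma digit_loop_correct:
  assumes "m r_one = 1" "m r_base = real b" "m r_weight = real w" "m r_next = real y"
    "m r_hi = real (x div b ^ l)" "m r_lo = real x" "m r_place = real (b ^ l)" "m r_count = real (Suc r)"
  obtains m' where "exec_within (WhilePos r_count digit_body) m (Suc r * Suc 18 + 1) m'"
    "agree_outside digit_regs m m'"
    "m' r_next = real (y + (\<Sum>c\<le>r. gain b l w x c * b ^ (l + c)))" "m' r_gain = real (gain b l w x r)"
proof -
  define I where "I z m' \<longleftrightarrow> agree_outside digit_regs m m'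
    \<and> m' r_next = real (y + (\<Sum>c<z. gain b l w x c * b ^ (l + c)))
    \<and> m' r_hi = real (x div b ^ (l + z)) \<and> m' r_lo = real (x div b ^ z) \<and> m' r_place = real (b ^ (l + z))
    \<and> (z > 0 \<longrightarrow> m' r_gain = real (gain b l w x (z - 1)))" for z m'
  obtain m' where loop: "exec_within (WhilePos r_count digit_body) m (Suc r * Suc 18 + 1) m'"
    and "I (Suc r) m'"
  proof (rule exec_within_countup[where I = I and m = m])
    fix z m1 assume "z < Suc r" and I: "I z m1" and "m1 r_count = real (Suc r - z)"
    then have count: "m1 r_count = real (Suc (r - z))" by (simp add: Suc_diff_le)
    have const: "m1 r_one = 1" "m1 r_base = real b" "m1 r_weight = real w"
      using I assms by (simp_all add: I_def agree_outside_def)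
    have regs: "m1 r_next = real (y + (\<Sum>c<z. gain b l w x c * b ^ (l + c)))"
      "m1 r_hi = real (x div b ^ (l + z))"
      "m1 r_lo = real (x div b ^ z)" "m1 r_place = real (b ^ (l + z))"
      using I unfolding I_def by blast+
    let ?g = "x div b ^ z mod b + w - x div b ^ (l + z) mod b"
    obtain m2 where m2: "exec_within digit_body m1 18 m2" "agree_outside digit_regs m1 m2"
      "m2 r_next = real (y + (\<Sum>c<z. gain b l w x c * b ^ (l + c)) + ?g * b ^ (l + z))"
      "m2 r_hi = real (x div b ^ (l + z) div b)" "m2 r_lo = real (x div b ^ z div b)"
      "m2 r_place = real (b ^ (l + z) * b)" "m2 r_count = real (r - z)" "m2 r_gain = real ?g"
      by (rule digit_body_correct[OF const regs count])
    have "agree_outside digit_regs m m2"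
      using I m2(2) by (auto simp: I_def intro: agree_outside_trans)
    moreover have "b ^ (l + z) * b = b ^ (l + Suc z)" "x div b ^ (l + z) div b = x div b ^ (l + Suc z)"
      "x div b ^ z div b = x div b ^ Suc z" "?g = gain b l w x z"
      by (simp_all add: div_mult2_eq[symmetric] mult.commute gain_def digit_def)
    ultimately have "I (Suc z) m2" using m2(3-6,8) by (simp add: I_def add.assoc)
    then show "\<exists>m'. exec_within digit_body m1 18 m' \<and> I (Suc z) m' \<and> m' r_count = real (Suc r - Suc z)"
      using m2(1,7) by auto
  qed (use assms in \<open>simp_all add: I_def agree_outside_def\<close>)
  show ?thesis
    using that[OF loop] \<open>I (Suc r) m'\<close> by (simp add: I_def lessThan_Suc_atMost)
qed

definition pass_value :: "nat \<Rightarrow> nat \<Rightarrow> nat \<Rightarrow> nat \<Rightarrow> real \<Rightarrow> real \<Rightarrow> real \<Rightarrow> (nat \<Rightarrow> real) \<Rightarrow> nat \<Rightarrow> real" where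
  "pass_value b L l w k p q F x =
    ((real (x div b ^ (L + 1)) + 1) * F (next_state b L l w x) + (k - real (x div b ^ (L + 1))) * F x) * p
    + real (gain b l w x (L - l)) * q"

lemma update_cell_correct:
  assumes "configured n L b U m" "n \<ge> 1" "m r_next = real y" "m r_x = real x" "m r_left = real (Suc r)"
  defines "s \<equiv> real (x div b ^ (L + 1))"
  obtains m' where "exec_within (straight update_cell) m 17 m'"
    "agree_outside (pass_regs \<union> {64 * n + x}) m m'"
    "m' r_x = real (Suc x)" "m' r_left = real r"
    "m' (64 * n + x) = ((s + 1) * m (64 * n + y) + (m r_item - s) * m (64 * n + x)) * m r_mix
      + m r_gain * m r_new"
proof
  let ?m = "fold step update_cell m"
  show "exec_within (straight update_cell) m 17 ?m"
    by (rule exec_within_straight) (simp_all add: update_cell_def)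
  have "\<lfloor>real x / m r_block\<rfloor> = int (x div b ^ (L + 1))"
    using assms(1) floor_divide_of_nat_eq[of x "b ^ (L + 1)"] by (simp only: configured_def)
  moreover have "nat \<lfloor>real z + m r_table\<rfloor> = 64 * n + z" for z
  proof -
    have "real z + m r_table = real (64 * n + z)" using assms(1) by (simp add: configured_def)
    then show ?thesis by (simp only: floor_of_nat nat_int)
  qed
  moreover have "m r_one = 1" using assms(1) by (simp add: configured_def)
  ultimately show "agree_outside (pass_regs \<union> {64 * n + x}) m ?m"
    "?m r_x = real (Suc x)" "?m r_left = real r"
    "?m (64 * n + x) = ((s + 1) * m (64 * n + y) + (m r_item - s) * m (64 * n + x)) * m r_mix
      + m r_gain * m r_new"
    using assms(2-5) by (simp_all add: update_cell_def agree_outside_def s_def mult_ac)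
qed

lemma scan_state_correct:
  assumes conf: "configured n L b U m"
    and item: "m r_len = real l" "l \<le> L" "m r_weight = real w" "m r_pow = real (b ^ l)"
    and x: "m r_x = real x"
  obtains m' where "exec_within scan_state m (19 * L + 27) m'" "agree_outside {r_next..r_tmp} m m'"
    "m' r_next = real (next_state b L l w x)" "m' r_gain = real (gain b l w x (L - l))"
proof -
  let ?y = "x + b ^ (L + 1)"
  define m1 where "m1 = fold step enter_state m"
  have enter: "exec_within (straight enter_state) m 7 m1"
    unfolding m1_def by (rule exec_within_straight) (simp_all add: enter_state_def)
  have agree1: "agree_outside {r_next..r_count} m m1"
    by (simp add: m1_def enter_state_def agree_outside_def)
  have "\<lfloor>real x / m r_pow\<rfloor> = int (x div b ^ l)"
    using item(4) floor_divide_of_nat_eq[of x "b ^ l"] by simp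
  then have regs1: "m1 r_one = 1" "m1 r_base = real b" "m1 r_weight = real w" "m1 r_next = real ?y"
    "m1 r_hi = real (x div b ^ l)" "m1 r_lo = real x" "m1 r_place = real (b ^ l)"
    "m1 r_count = real (Suc (L - l))"
    using conf item x by (simp_all add: m1_def enter_state_def configured_def of_nat_diff)
  obtain m2 where scan: "exec_within (WhilePos r_count digit_body) m1 (Suc (L - l) * Suc 18 + 1) m2"
    and agree2: "agree_outside digit_regs m1 m2"
    and "m2 r_next = real (?y + (\<Sum>c\<le>L - l. gain b l w x c * b ^ (l + c)))"
    and gain: "m2 r_gain = real (gain b l w x (L - l))"
    using digit_loop_correct[OF regs1] .
  then have "m2 r_next = real (next_state b L l w x)" by (simp add: next_state_def)
  moreover have "agree_outside {r_next..r_tmp} m m2"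
    using agree1 agree2 by (rule agree_outside_trans) auto
  moreover have "exec_within scan_state m (19 * L + 27) m2"
    unfolding scan_state_def by (rule exec_within_mono[OF exec_within_Seq[OF enter scan]]) simp
  ultimately show ?thesis using that gain by blast
qed

lemma pass_body_correct:
  assumes conf: "configured n L b U m" "n \<ge> 1"
    and item: "m r_len = real l" "l \<le> L" "m r_weight = real w" "m r_pow = real (b ^ l)"
    and state: "m r_x = real x" "m r_left = real (Suc r)"
  obtains m' where "exec_within pass_body m (19 * L + 44) m'"
    "agree_outside (pass_regs \<union> {64 * n + x}) m m'" "m' r_x = real (Suc x)" "m' r_left = real r"
    "m' (64 * n + x) = pass_value b L l w (m r_item) (m r_mix) (m r_new) (\<lambda>y. m (64 * n + y)) x"
proof -
  obtain m1 where scan: "exec_within scan_state m (19 * L + 27) m1"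
    and agree1: "agree_outside {r_next..r_tmp} m m1"
    and next1: "m1 r_next = real (next_state b L l w x)" and gain1: "m1 r_gain = real (gain b l w x (L - l))"
    using scan_state_correct[OF conf(1) item state(1)] .
  have conf1: "configured n L b U m1" by (rule configured_frame[OF conf(1) agree1]) auto
  have state1: "m1 r_x = real x" "m1 r_left = real (Suc r)"
    and same1: "m1 r_item = m r_item" "m1 r_mix = m r_mix" "m1 r_new = m r_new"
      "m1 (64 * n + y) = m (64 * n + y)" for y
    using agree1 state conf(2) by (simp_all add: agree_outside_def)
  obtain m2 where update: "exec_within (straight update_cell) m1 17 m2"
    and agree2: "agree_outside (pass_regs \<union> {64 * n + x}) m1 m2"
    and post: "m2 r_x = real (Suc x)" "m2 r_left = real r"
      "m2 (64 * n + x) = pass_value b L l w (m r_item) (m r_mix) (m r_new) (\<lambda>y. m (64 * n + y)) x"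
    by (rule update_cell_correct[OF conf1 conf(2) next1 state1]) (simp add: pass_value_def gain1 same1)
  have "exec_within pass_body m (19 * L + 44) m2"
    unfolding pass_body_def by (rule exec_within_mono[OF exec_within_Seq[OF scan update]]) simp
  moreover have "agree_outside (pass_regs \<union> {64 * n + x}) m m2"
    using agree1 agree2 by (rule agree_outside_trans) auto
  ultimately show ?thesis using post by (rule that)
qed

lemma pass_value_cong:
  assumes "b > 0" "\<And>y. x \<le> y \<Longrightarrow> F y = G y"
  shows "pass_value b L l w k p q F x = pass_value b L l w k p q G x"
  using assms by (simp add: pass_value_def next_state_def)

definition prefix_updated :: "nat \<Rightarrow> (nat \<Rightarrow> real) \<Rightarrow> nat \<Rightarrow> mem \<Rightarrow> mem \<Rightarrow> bool" where
  "prefix_updated n f z m m' \<longleftrightarrow> agree_outside (pass_regs \<union> {64 * n..<64 * n + z}) m m'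
     \<and> m' r_x = real z \<and> (\<forall>x<z. m' (64 * n + x) = f x)"

text \<open>The table is updated in place: the successors of a state are larger than the state itself, so in
  ascending order every state is treated before its successors are overwritten.\<close>

lemma pass_body_prefix_updated:
  assumes conf: "configured n L b U m" "n \<ge> 1" "b > 0"
    and item: "m r_len = real l" "l \<le> L" "m r_weight = real w" "m r_pow = real (b ^ l)"
  defines "f \<equiv> pass_value b L l w (m r_item) (m r_mix) (m r_new) (\<lambda>y. m (64 * n + y))"
  assumes prefix: "prefix_updated n f z m m1" and left: "m1 r_left = real (Suc r)"
  obtains m2 where "exec_within pass_body m1 (19 * L + 44) m2" "prefix_updated n f (Suc z) m m2"
    "m2 r_left = real r"
proof -
  have agree1: "agree_outside (pass_regs \<union> {64 * n..<64 * n + z}) m m1" and x1: "m1 r_x = real z"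
    and updated: "\<And>x. x < z \<Longrightarrow> m1 (64 * n + x) = f x"
    using prefix by (simp_all add: prefix_updated_def)
  have conf1: "configured n L b U m1"
    by (rule configured_frame[OF conf(1) agree1]) (use conf(2) in auto)
  have item1: "m1 r_len = real l" "m1 r_weight = real w" "m1 r_pow = real (b ^ l)"
    and same1: "m1 r_item = m r_item" "m1 r_mix = m r_mix" "m1 r_new = m r_new"
    using agree1 item conf(2) by (simp_all add: agree_outside_def)
  obtain m2 where body: "exec_within pass_body m1 (19 * L + 44) m2"
    and agree2: "agree_outside (pass_regs \<union> {64 * n + z}) m1 m2"
    and x2: "m2 r_x = real (Suc z)" and left2: "m2 r_left = real r"
    and cell: "m2 (64 * n + z) = pass_value b L l w (m1 r_item) (m1 r_mix) (m1 r_new) (\<lambda>y. m1 (64 * n + y)) z"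
    using pass_body_correct[OF conf1 conf(2) item1(1) item(2) item1(2,3) x1 left] .
  have "m1 (64 * n + y) = m (64 * n + y)" if "z \<le> y" for y
    using agree1 conf(2) that by (simp add: agree_outside_def)
  then have "m2 (64 * n + z) = f z"
    unfolding cell f_def same1 by (rule pass_value_cong[OF conf(3)])
  moreover have "m2 (64 * n + x) = f x" if "x < z" for x
    using agree2 updated[OF that] that conf(2) by (simp add: agree_outside_def)
  moreover have "agree_outside (pass_regs \<union> {64 * n..<64 * n + Suc z}) m m2"
    using agree1 agree2 by (rule agree_outside_trans) auto
  ultimately have "prefix_updated n f (Suc z) m m2" using x2 by (simp add: prefix_updated_def less_Suc_eq)
  then show ?thesis using that body left2 by blast
qed

lemma pass_loop_correct:
  assumes conf: "configured n L b U m" "n \<ge> 1" "b > 0"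
    and item: "m r_len = real l" "l \<le> L" "m r_weight = real w" "m r_pow = real (b ^ l)"
    and init: "m r_x = 0" "m r_left = real N"
  obtains m' where "exec_within (WhilePos r_left pass_body) m (N * Suc (19 * L + 44) + 1) m'"
    "agree_outside (pass_regs \<union> {64 * n..}) m m'"
    "\<And>x. x < N \<Longrightarrow> m' (64 * n + x)
      = pass_value b L l w (m r_item) (m r_mix) (m r_new) (\<lambda>y. m (64 * n + y)) x"
proof -
  let ?f = "pass_value b L l w (m r_item) (m r_mix) (m r_new) (\<lambda>y. m (64 * n + y))"
  obtain m' where loop: "exec_within (WhilePos r_left pass_body) m (N * Suc (19 * L + 44) + 1) m'"
    and prefix: "prefix_updated n ?f N m m'"
  proof (rule exec_within_countup[where I = "\<lambda>z m'. prefix_updated n ?f z m m'" and m = m])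
    fix z m1 assume "z < N" and prefix1: "prefix_updated n ?f z m m1" and "m1 r_left = real (N - z)"
    then have "m1 r_left = real (Suc (N - Suc z))" by (simp add: Suc_diff_Suc)
    then show "\<exists>m'. exec_within pass_body m1 (19 * L + 44) m' \<and> prefix_updated n ?f (Suc z) m m'
        \<and> m' r_left = real (N - Suc z)"
      using pass_body_prefix_updated[OF conf item prefix1] by blast
  qed (use init in \<open>simp_all add: prefix_updated_def agree_outside_def\<close>)
  have "agree_outside (pass_regs \<union> {64 * n..}) m m'"
    using prefix unfolding prefix_updated_def agree_outside_def by auto
  then show ?thesis using that[OF loop] prefix by (simp add: prefix_updated_def)
qed

definition pass_time :: "nat \<Rightarrow> nat \<Rightarrow> nat \<Rightarrow> nat" where
  "pass_time n L b = (n + 1) * b ^ (L + 1) * (19 * L + 45) + 3 * L + 7"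

lemma table_pass_correct:
  assumes conf: "configured n L b U m" "n \<ge> 1" "b > 0"
    and item: "m r_len = real l" "l \<le> L" "m r_weight = real w"
  obtains m' where "exec_within table_pass m (pass_time n L b) m'"
    "agree_outside ({r_x..r_tmp} \<union> {64 * n..}) m m'"
    "\<And>x. x < (n + 1) * b ^ (L + 1) \<Longrightarrow> m' (64 * n + x)
      = pass_value b L l w (m r_item) (m r_mix) (m r_new) (\<lambda>y. m (64 * n + y)) x"
proof -
  let ?N = "(n + 1) * b ^ (L + 1)"
  let ?count = "[copy r_count r_len]"
  let ?start = "[SetConst r_x 0, SetOp r_left Add r_n r_one, SetOp r_left Mul r_left r_block]"
  define m1 where "m1 = fold step ?count m"
  have count: "exec_within (straight ?count) m 1 m1"
    unfolding m1_def by (rule exec_within_straight) simp_all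
  have regs1: "m1 r_one = 1" "m1 r_base = real b" "m1 r_count = real l"
    using conf(1) item(1) by (simp_all add: m1_def configured_def)
  obtain m2 where power: "exec_within set_power m1 (3 * l + 2) m2"
    and agree2: "agree_outside {r_pow, r_count} m1 m2" and pow2: "m2 r_pow = real (b ^ l)"
    using set_power_correct[OF regs1] .
  define m3 where "m3 = fold step ?start m2"
  have start: "exec_within (straight ?start) m2 3 m3"
    unfolding m3_def by (rule exec_within_straight) simp_all
  have agree3: "agree_outside {r_x..r_tmp} m m3"
    using agree2 by (auto simp: m1_def m3_def agree_outside_def)
  then have conf3: "configured n L b U m3" by (rule configured_frame[OF conf(1)]) auto
  have regs3: "m3 r_len = real l" "m3 r_weight = real w" "m3 r_pow = real (b ^ l)" "m3 r_x = 0"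
    "m3 r_left = real ?N"
    and same: "m3 r_item = m r_item" "m3 r_mix = m r_mix" "m3 r_new = m r_new"
      "m3 (64 * n + y) = m (64 * n + y)" for y
    using agree2 agree3 conf item pow2
    by (simp_all add: m1_def m3_def agree_outside_def configured_def algebra_simps)
  obtain m4 where loop: "exec_within (WhilePos r_left pass_body) m3 (?N * Suc (19 * L + 44) + 1) m4"
    and agree4: "agree_outside (pass_regs \<union> {64 * n..}) m3 m4"
    and cells: "\<And>x. x < ?N \<Longrightarrow> m4 (64 * n + x)
      = pass_value b L l w (m r_item) (m r_mix) (m r_new) (\<lambda>y. m (64 * n + y)) x"
    using pass_loop_correct[OF conf3 conf(2,3) regs3(1) item(2) regs3(2-5)] unfolding same by blast
  note count also note power also note start also note loop
  finally have "exec_within table_pass m (pass_time n L b) m4"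
    unfolding table_pass_def pass_time_def
    by (rule exec_within_mono) (use item(2) in \<open>simp add: algebra_simps\<close>)
  moreover have "agree_outside ({r_x..r_tmp} \<union> {64 * n..}) m m4"
    using agree3 agree4 by (rule agree_outside_trans) auto
  ultimately show ?thesis using cells by (rule that)
qed

section \<open>Loading items and computing the parameters\<close>

definition address :: "nat \<Rightarrow> nat \<Rightarrow> nat" where
  "address n k = 2 * k + 2 + (if 2 * k + 2 < 32 then 32 * n - 4 else 0)"

definition items_stored :: "nat \<Rightarrow> (nat \<Rightarrow> nat) \<Rightarrow> (nat \<Rightarrow> nat) \<Rightarrow> mem \<Rightarrow> bool" where
  "items_stored n l w m \<longleftrightarrow> (\<forall>k\<in>{1..n}. m (address n k) = real (l k) \<and> m (Suc (address n k)) = real (w k))"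

lemma address_bounds:
  assumes "k \<in> {1..n}"
  shows "32 \<le> address n k" "Suc (address n k) < 64 * n"
  using assms by (auto simp: address_def)

lemma address_inject:
  assumes "k \<in> {1..n}" "k' \<in> {1..n}"
  shows "address n k = address n k' \<longleftrightarrow> k = k'"
  using assms by (auto simp: address_def)

lemma address_neq_Suc: "address n k \<noteq> Suc (address n k')"
proof -
  have "even (address n j)" for j by (simp add: address_def)
  then show ?thesis by (metis even_Suc)
qed

lemma items_stored_frame:
  assumes "items_stored n l w m" "agree_outside A m m'" "A \<subseteq> {..<32} \<union> {64 * n..}"
  shows "items_stored n l w m'"
  unfolding items_stored_def
proof
  fix k assume k: "k \<in> {1..n}"
  then have "address n k \<notin> A" "Suc (address n k) \<notin> A"
    using address_bounds[OF k] assms(3) by auto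
  then show "m' (address n k) = real (l k) \<and> m' (Suc (address n k)) = real (w k)"
    using assms(1,2) k by (simp add: items_stored_def agree_outside_def)
qed

lemma load_item_correct:
  assumes "m r_one = 1" "m r_saved = 32 * real n - 4" "m r_item = real k" "k \<in> {1..n}" "items_stored n l w m"
  obtains m' where "exec_within load_item m 10 m'" "agree_outside load_regs m m'"
    "m' r_addr = real (address n k)" "m' r_tmp = real (Suc (address n k))"
    "m' r_len = real (l k)" "m' r_weight = real (w k)"
proof -
  let ?locate = "[SetOp r_addr Add r_item r_item, SetConst r_tmp 2, SetOp r_addr Add r_addr r_tmp,
    SetConst r_tmp 32, SetOp r_tmp Sub r_tmp r_addr]"
  let ?fetch = "[LoadInd r_len r_addr, SetOp r_tmp Add r_addr r_one, LoadInd r_weight r_tmp]"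
  define m1 where "m1 = fold step ?locate m"
  define m2 where "m2 = m1(r_addr := real (address n k))"
  define m3 where "m3 = fold step ?fetch m2"
  have m1: "m1 = m(r_addr := real (2 * k + 2), r_tmp := 30 - 2 * real k)"
    using assms(3) by (simp add: m1_def fun_upd_twist add.commute)
  have locate: "exec_within (straight ?locate) m 5 m1"
    unfolding m1_def by (rule exec_within_straight) simp_all
  have relocate: "exec_within (IfPos r_tmp (straight [SetOp r_addr Add r_addr r_saved]) SKIP) m1 (Suc 1) m2"
  proof (rule exec_within_IfPos)
    assume "m1 r_tmp > 0"
    then have "m2 = step (SetOp r_addr Add r_addr r_saved) m1"
      using assms(2,4) by (auto simp: m1 m2_def address_def of_nat_diff)
    then show "exec_within (straight [SetOp r_addr Add r_addr r_saved]) m1 1 m2"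
      using exec_within_straight[of "[SetOp r_addr Add r_addr r_saved]" 1 m1] by simp
  next
    assume "\<not> m1 r_tmp > 0"
    then have "m2 = m1" by (auto simp: m1 m2_def address_def)
    then show "exec_within SKIP m1 1 m2" using exec_within_mono[OF exec_within_Skip] by simp
  qed
  have fetch: "exec_within (straight ?fetch) m2 3 m3"
    unfolding m3_def by (rule exec_within_straight) simp_all
  note locate also note relocate also note fetch
  finally have "exec_within load_item m 10 m3"
    unfolding load_item_def by (rule exec_within_mono) simp
  moreover have "m (address n k) = real (l k)" "m (Suc (address n k)) = real (w k)"
    using assms(4,5) by (auto simp: items_stored_def)
  moreover have "nat (int (address n k) + 1) = Suc (address n k)" by linarith
  ultimately show ?thesis
    using address_bounds(1)[OF assms(4)] assms(1)
    by (intro that[of m3]) (simp_all add: m1 m2_def m3_def agree_outside_def)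
qed

lemma density_body_correct:
  assumes regs: "m r_one = 1" "m r_saved = 32 * real n - 4" "m r_item = real (Suc k)"
    and k: "Suc k \<in> {1..n}" and stored: "items_stored n l w m"
  obtains m' where "exec_within density_body m 15 m'" "agree_outside unit_regs m m'"
    "m' r_item = real k" "m' r_unit = max (real (w (Suc k)) / real (l (Suc k))) (m r_unit)"
proof -
  let ?compare = "[SetOp r_ratio Dvd r_weight r_len, SetOp r_tmp Sub r_ratio r_unit]"
  obtain m1 where load: "exec_within load_item m 10 m1" and agree1: "agree_outside load_regs m m1"
    and item1: "m1 r_len = real (l (Suc k))" "m1 r_weight = real (w (Suc k))"
    using load_item_correct[OF regs k stored] by blast
  define m2 where "m2 = fold step ?compare m1"
  define m3 where "m3 = m2(r_unit := max (m2 r_ratio) (m2 r_unit))"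
  define m4 where "m4 = fold step [SetOp r_item Sub r_item r_one] m3"
  have compare: "exec_within (straight ?compare) m1 2 m2"
    unfolding m2_def by (rule exec_within_straight) simp_all
  have update: "exec_within (IfPos r_tmp (straight [copy r_unit r_ratio]) SKIP) m2 (Suc 1) m3"
  proof (rule exec_within_IfPos)
    assume "m2 r_tmp > 0"
    moreover have "m2 r_one = 1" using agree1 regs(1) by (simp add: m2_def agree_outside_def)
    ultimately have "m3 = step (copy r_unit r_ratio) m2"
      unfolding m3_def by (simp add: m2_def)
    then show "exec_within (straight [copy r_unit r_ratio]) m2 1 m3"
      using exec_within_straight[of "[copy r_unit r_ratio]" 1 m2] by simp
  next
    assume "\<not> m2 r_tmp > 0"
    then have "m3 = m2" unfolding m3_def by (simp add: m2_def fun_upd_idem_iff)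
    then show "exec_within SKIP m2 1 m3" using exec_within_mono[OF exec_within_Skip] by simp
  qed
  have count: "exec_within (straight [SetOp r_item Sub r_item r_one]) m3 1 m4"
    unfolding m4_def by (rule exec_within_straight) simp_all
  note load also note compare also note update also note count
  finally have "exec_within density_body m 15 m4"
    unfolding density_body_def by (rule exec_within_mono) simp
  then show ?thesis
    using agree1 regs item1 by (intro that[of m4]) (auto simp: m2_def m3_def m4_def agree_outside_def)
qed

lemma density_loop_correct:
  assumes regs: "m r_one = 1" "m r_saved = 32 * real n - 4" "m r_item = real n" "m r_unit = 0"
    and stored: "items_stored n l w m" and n: "n \<ge> 1"
  obtains m' where "exec_within (WhilePos r_item density_body) m (n * Suc 15 + 1) m'"
    "agree_outside unit_regs m m'" "m' r_unit = max_density l w {1..n}"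
proof -
  define f where "f k = real (w k) / real (l k)" for k
  define I where "I k m' \<longleftrightarrow> agree_outside unit_regs m m'
    \<and> m' r_unit = Max (insert 0 (f ` {Suc k..n}))" for k m'
  obtain m' where loop: "exec_within (WhilePos r_item density_body) m (n * Suc 15 + 1) m'" and "I 0 m'"
  proof (rule exec_within_countdown[where I = I and m = m])
    fix k m1 assume k: "k < n" and I: "I (Suc k) m1" and item1: "m1 r_item = real (Suc k)"
    have regs1: "m1 r_one = 1" "m1 r_saved = 32 * real n - 4"
      using I regs by (simp_all add: I_def agree_outside_def)
    have "Suc k \<in> {1..n}" using k by simp
    moreover have "items_stored n l w m1"
      using I by (auto simp: I_def intro: items_stored_frame[OF stored])
    ultimately obtain m2 where m2: "exec_within density_body m1 15 m2" "agree_outside unit_regs m1 m2"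
      "m2 r_item = real k" "m2 r_unit = max (f (Suc k)) (m1 r_unit)"
      using density_body_correct[OF regs1 item1] unfolding f_def by blast
    have "insert 0 (f ` {Suc k..n}) = insert (f (Suc k)) (insert 0 (f ` {Suc (Suc k)..n}))"
      using k by (simp add: atLeastAtMost_insertL[symmetric] insert_commute)
    then have "Max (insert 0 (f ` {Suc k..n})) = max (f (Suc k)) (Max (insert 0 (f ` {Suc (Suc k)..n})))"
      by simp
    then have "I k m2"
      using I m2(2,4) by (auto simp: I_def intro: agree_outside_trans)
    then show "\<exists>m'. exec_within density_body m1 15 m' \<and> I k m' \<and> m' r_item = real k"
      using m2(1,3) by blast
  qed (use regs in \<open>simp_all add: I_def agree_outside_def\<close>)
  have "Max (insert 0 (f ` {1..n})) = max_density l w {1..n}"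
    using max_density_nonneg[of "{1..n}" l w] n by (simp add: max_density_def f_def)
  then show ?thesis using that[OF loop] \<open>I 0 m'\<close> by (simp add: I_def)
qed

lemma set_unit_correct:
  assumes regs: "m r_n = real n" "m r_one = 1" "m r_saved = 32 * real n - 4"
    and stored: "items_stored n l w m" and n: "n \<ge> 1"
  obtains m' where "exec_within set_unit m (16 * n + 4) m'" "agree_outside unit_regs m m'"
    "m' r_unit = m r_eps * max_density l w {1..n}"
proof -
  let ?start = "[SetConst r_unit 0, copy r_item r_n]"
  let ?scale = "[SetOp r_unit Mul r_unit r_eps]"
  define m1 where "m1 = fold step ?start m"
  have start: "exec_within (straight ?start) m 2 m1"
    unfolding m1_def by (rule exec_within_straight) simp_all
  have agree1: "agree_outside unit_regs m m1" by (simp add: m1_def agree_outside_def)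
  have regs1: "m1 r_one = 1" "m1 r_saved = 32 * real n - 4" "m1 r_item = real n" "m1 r_unit = 0"
    using regs by (simp_all add: m1_def)
  have "items_stored n l w m1" by (rule items_stored_frame[OF stored agree1]) auto
  then obtain m2 where loop: "exec_within (WhilePos r_item density_body) m1 (n * Suc 15 + 1) m2"
    and agree2: "agree_outside unit_regs m1 m2" and unit2: "m2 r_unit = max_density l w {1..n}"
    using density_loop_correct[OF regs1] n by blast
  define m3 where "m3 = fold step ?scale m2"
  have scale: "exec_within (straight ?scale) m2 1 m3"
    unfolding m3_def by (rule exec_within_straight) simp_all
  note start also note loop also note scale
  finally have "exec_within set_unit m (16 * n + 4) m3"
    unfolding set_unit_def by (rule exec_within_mono) simp
  then show ?thesis
    using agree1 agree2 unit2 by (intro that[of m3]) (simp_all add: m3_def agree_outside_def)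
qed

lemma set_base_correct:
  assumes "m r_cap = real L" "m r_eps > 0" "m r_one = 1"
  defines "b \<equiv> nat \<lfloor>real L / m r_eps\<rfloor> + 1"
  obtains m' where "exec_within set_base m (3 * L + 10) m'"
    "agree_outside {r_base, r_block, r_pow, r_count} m m'"
    "m' r_base = real b" "m' r_block = real (b ^ (L + 1))"
proof -
  let ?start = "[SetOp r_base Dvd r_cap r_eps, SetFloor r_base r_base, SetOp r_base Add r_base r_one,
    SetOp r_count Add r_cap r_one]"
  define m1 where "m1 = fold step ?start m"
  have start: "exec_within (straight ?start) m 4 m1"
    unfolding m1_def by (rule exec_within_straight) simp_all
  have regs1: "m1 r_one = 1" "m1 r_base = real b" "m1 r_count = real (L + 1)"
    using assms by (simp_all add: m1_def b_def)
  obtain m2 where power: "exec_within set_power m1 (3 * (L + 1) + 2) m2"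
    and agree2: "agree_outside {r_pow, r_count} m1 m2" and pow2: "m2 r_pow = real (b ^ (L + 1))"
    using set_power_correct[OF regs1] .
  define m3 where "m3 = fold step [copy r_block r_pow] m2"
  have store: "exec_within (straight [copy r_block r_pow]) m2 1 m3"
    unfolding m3_def by (rule exec_within_straight) simp_all
  note start also note power also note store
  finally have "exec_within set_base m (3 * L + 10) m3"
    unfolding set_base_def by (rule exec_within_mono) simp
  moreover have "agree_outside {r_base, r_block, r_pow, r_count} m m3"
    using agree2 by (simp add: m1_def m3_def agree_outside_def)
  moreover have "m3 r_base = real b" "m3 r_block = real (b ^ (L + 1))"
    using agree2 regs1 pow2 by (simp_all add: m3_def agree_outside_def)
  ultimately show ?thesis by (rule that)
qed

section \<open>Averaging over the agents\<close>

definition ready :: "nat \<Rightarrow> (nat \<Rightarrow> nat) \<Rightarrow> (nat \<Rightarrow> nat) \<Rightarrow> nat \<Rightarrow> nat \<Rightarrow> real \<Rightarrow> mem \<Rightarrow> bool" where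
  "ready n l w L b U m \<longleftrightarrow> n \<ge> 1 \<and> b > 0 \<and> U \<ge> 0 \<and> configured n L b U m \<and> items_stored n l w m"

lemma ready_frame:
  assumes "ready n l w L b U m" "agree_outside A m m'" "A \<subseteq> {10..<32} \<union> {64 * n..}"
  shows "ready n l w L b U m'"
proof -
  have "A \<subseteq> {10..}" "A \<subseteq> {..<32} \<union> {64 * n..}"
    using assms(1,3) by (auto simp: ready_def)
  then show ?thesis
    using assms(1) configured_frame[OF _ assms(2)] items_stored_frame[OF _ assms(2)] by (simp add: ready_def)
qed

lemma ready_load_item:
  assumes "ready n l w L b U m" "m r_item = real k" "k \<in> {1..n}"
  obtains m' where "exec_within load_item m 10 m'" "agree_outside load_regs m m'"
    "ready n l w L b U m'" "m' r_addr = real (address n k)" "m' r_tmp = real (Suc (address n k))"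
    "m' r_len = real (l k)" "m' r_weight = real (w k)"
proof -
  have const: "m r_one = 1" "m r_saved = 32 * real n - 4" and stored: "items_stored n l w m"
    using assms(1) by (simp_all add: ready_def configured_def)
  obtain m' where m': "exec_within load_item m 10 m'" "agree_outside load_regs m m'"
    "m' r_addr = real (address n k)" "m' r_tmp = real (Suc (address n k))"
    "m' r_len = real (l k)" "m' r_weight = real (w k)"
    using load_item_correct[OF const assms(2,3) stored] .
  have "ready n l w L b U m'" by (rule ready_frame[OF assms(1) m'(2)]) auto
  then show ?thesis using that m' by blast
qed

lemma ready_table_pass:
  assumes ready: "ready n l w L b U m" and item: "m r_len = real l'" "l' \<le> L" "m r_weight = real w'"
  obtains m' where "exec_within table_pass m (pass_time n L b) m'"
    "agree_outside ({r_x..r_tmp} \<union> {64 * n..}) m m'"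
    "ready n l w L b U m'"
    "\<And>x. x < (n + 1) * b ^ (L + 1) \<Longrightarrow> m' (64 * n + x)
      = pass_value b L l' w' (m r_item) (m r_mix) (m r_new) (\<lambda>y. m (64 * n + y)) x"
proof -
  obtain m' where m': "exec_within table_pass m (pass_time n L b) m'"
    "agree_outside ({r_x..r_tmp} \<union> {64 * n..}) m m'"
    "\<And>x. x < (n + 1) * b ^ (L + 1) \<Longrightarrow> m' (64 * n + x)
      = pass_value b L l' w' (m r_item) (m r_mix) (m r_new) (\<lambda>y. m (64 * n + y)) x"
    using table_pass_correct[OF _ _ _ item, of n b U] ready unfolding ready_def by blast
  have "ready n l w L b U m'" by (rule ready_frame[OF ready m'(2)]) auto
  then show ?thesis using that m' by blast
qed

lemma items_stored_erase:
  assumes "items_stored n l w m" "i \<in> {1..n}"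
  shows "items_stored n (l(i := 0)) (w(i := 0)) (m(address n i := 0, Suc (address n i) := 0))"
  unfolding items_stored_def
proof
  fix k assume k: "k \<in> {1..n}"
  show "(m(address n i := 0, Suc (address n i) := 0)) (address n k) = real ((l(i := 0)) k)
    \<and> (m(address n i := 0, Suc (address n i) := 0)) (Suc (address n k)) = real ((w(i := 0)) k)"
    using assms k address_inject[OF k assms(2)] address_neq_Suc[of n k i] address_neq_Suc[of n i k]
    by (auto simp: items_stored_def)
qed

lemma prepare_agent_correct:
  assumes ready: "ready n l w L b U m" and i: "i \<in> {1..n}"
    and addr: "m r_addr = real (address n i)" "m r_tmp = real (Suc (address n i))"
    and weight: "m r_weight = real (w i)"
  obtains m' where "exec_within (straight prepare_agent) m 7 m'" "ready n (l(i := 0)) (w(i := 0)) L b U m'"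
    "m' r_len = m r_len" "m' r_weight = real (rounded U w i)" "m' r_mix = 0" "m' r_new = 1"
proof -
  let ?m = "m(address n i := 0, Suc (address n i) := 0)"
  define m' where "m' = fold step prepare_agent m"
  have far: "address n i \<ge> 32" using address_bounds[OF i] by simp
  have "U \<ge> 0" "m r_unit = U" using ready by (simp_all add: ready_def configured_def)
  moreover have "nat (1 + int (address n i)) = Suc (address n i)" by linarith
  ultimately have m': "m' = ?m(r_zero := 0, r_weight := real (rounded U w i), r_mix := 0, r_new := 1)"
    using addr weight far by (auto simp: m'_def prepare_agent_def round_weight_def of_int_floor_rounded)
  have "ready n (l(i := 0)) (w(i := 0)) L b U ?m"
    using ready items_stored_erase[of n l w m i] i far by (simp add: ready_def configured_def)
  moreover have "agree_outside {r_zero, r_weight, r_mix, r_new} ?m m'"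
    by (simp add: m' agree_outside_def)
  ultimately have "ready n (l(i := 0)) (w(i := 0)) L b U m'"
    by (rule ready_frame) auto
  moreover have "exec_within (straight prepare_agent) m 7 m'"
    unfolding m'_def by (rule exec_within_straight) (simp_all add: prepare_agent_def round_weight_def)
  ultimately show ?thesis using far by (intro that[of m']) (simp_all add: m')
qed

lemma set_marginals_correct:
  assumes ready: "ready n l w L b U m" and i: "m r_agent = real i" "i \<in> {1..n}" "l i \<le> L"
  obtains m' where "exec_within set_marginals m (18 + pass_time n L b) m'"
    "ready n (l(i := 0)) (w(i := 0)) L b U m'"
    "\<And>x. x < (n + 1) * b ^ (L + 1) \<Longrightarrow> m' (64 * n + x) = real (gain b (l i) (rounded U w i) x (L - l i))"
proof -
  define m1 where "m1 = fold step [copy r_item r_agent] m"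
  have select: "exec_within (straight [copy r_item r_agent]) m 1 m1"
    unfolding m1_def by (rule exec_within_straight) simp_all
  have "agree_outside {r_item} m m1" by (simp add: m1_def agree_outside_def)
  then have "ready n l w L b U m1" by (rule ready_frame[OF ready]) auto
  moreover have "m1 r_item = real i" using ready i(1) by (simp add: m1_def ready_def configured_def)
  ultimately obtain m2 where load: "exec_within load_item m1 10 m2" and ready2: "ready n l w L b U m2"
    and addr2: "m2 r_addr = real (address n i)" "m2 r_tmp = real (Suc (address n i))"
    and item2: "m2 r_len = real (l i)" "m2 r_weight = real (w i)"
    using ready_load_item i(2) by blast
  obtain m3 where prepare: "exec_within (straight prepare_agent) m2 7 m3"
    and ready3: "ready n (l(i := 0)) (w(i := 0)) L b U m3" and len3: "m3 r_len = m2 r_len"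
    and regs3: "m3 r_weight = real (rounded U w i)" "m3 r_mix = 0" "m3 r_new = 1"
    using prepare_agent_correct[OF ready2 i(2) addr2 item2(2)] .
  obtain m4 where pass: "exec_within table_pass m3 (pass_time n L b) m4"
    and ready4: "ready n (l(i := 0)) (w(i := 0)) L b U m4"
    and cells: "\<And>x. x < (n + 1) * b ^ (L + 1) \<Longrightarrow> m4 (64 * n + x) = pass_value b L (l i) (rounded U w i)
      (m3 r_item) (m3 r_mix) (m3 r_new) (\<lambda>y. m3 (64 * n + y)) x"
    using ready_table_pass[OF ready3 len3[unfolded item2(1)] i(3) regs3(1)] by blast
  note select also note load also note prepare also note pass
  finally have exec: "exec_within set_marginals m (18 + pass_time n L b) m4"
    unfolding set_marginals_def by (rule exec_within_mono) simp
  show ?thesis by (rule that[OF exec ready4]) (simp add: cells pass_value_def regs3)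
qed

lemma prepare_item_correct:
  assumes ready: "ready n l w L b U m" and item: "m r_item = real (Suc k)" "m r_weight = real (w (Suc k))"
  obtains m' where "exec_within (straight prepare_item) m 5 m'" "ready n l w L b U m'"
    "agree_outside {r_weight, r_mix, r_new} m m'"
    "m' r_weight = real (rounded U w (Suc k))" "m' r_new = 0" "m' r_mix = 1 / (real k + 2)"
proof -
  define m' where "m' = fold step prepare_item m"
  have agree: "agree_outside {r_weight, r_mix, r_new} m m'"
    by (simp add: m'_def prepare_item_def round_weight_def agree_outside_def)
  then have "ready n l w L b U m'" by (rule ready_frame[OF ready]) auto
  moreover have "exec_within (straight prepare_item) m 5 m'"
    unfolding m'_def by (rule exec_within_straight) (simp_all add: prepare_item_def round_weight_def)
  moreover have "U \<ge> 0" "m r_unit = U" "m r_one = 1" using ready by (simp_all add: ready_def configured_def)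
  ultimately show ?thesis
    using agree item
    by (intro that[of m']) (simp_all add: m'_def prepare_item_def round_weight_def of_int_floor_rounded)
qed

lemma add_item_correct:
  assumes ready: "ready n l w L b U m" and k: "m r_item = real (Suc k)" "Suc k \<in> {1..n}" "l (Suc k) \<le> L"
  obtains m' where "exec_within add_item m (16 + pass_time n L b) m'" "ready n l w L b U m'"
    "m' r_item = real k"
    "\<And>x. x < (n + 1) * b ^ (L + 1) \<Longrightarrow> m' (64 * n + x) =
      ((real (x div b ^ (L + 1)) + 1) * m (64 * n + next_state b L (l (Suc k)) (rounded U w (Suc k)) x)
       + (real k + 1 - real (x div b ^ (L + 1))) * m (64 * n + x)) / (real k + 2)"
proof -
  let ?count = "[SetOp r_item Sub r_item r_one]"
  obtain m1 where load: "exec_within load_item m 10 m1" and agree1: "agree_outside load_regs m m1"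
    and ready1: "ready n l w L b U m1"
    and item1: "m1 r_len = real (l (Suc k))" "m1 r_weight = real (w (Suc k))"
    using ready_load_item[OF ready k(1,2)] by blast
  have "m1 r_item = real (Suc k)" using agree1 k(1) by (simp add: agree_outside_def)
  then obtain m2 where prepare: "exec_within (straight prepare_item) m1 5 m2"
    and ready2: "ready n l w L b U m2"
    and agree2: "agree_outside {r_weight, r_mix, r_new} m1 m2"
    and regs2: "m2 r_weight = real (rounded U w (Suc k))" "m2 r_new = 0" "m2 r_mix = 1 / (real k + 2)"
    using prepare_item_correct[OF ready1 _ item1(2)] by blast
  have same2: "m2 r_len = real (l (Suc k))" "m2 r_item = real k + 1" "m2 (64 * n + y) = m (64 * n + y)" for y
    using agree1 agree2 item1(1) k(1,2) by (simp_all add: agree_outside_def)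
  obtain m3 where pass: "exec_within table_pass m2 (pass_time n L b) m3"
    and agree3: "agree_outside ({r_x..r_tmp} \<union> {64 * n..}) m2 m3" and ready3: "ready n l w L b U m3"
    and cells3: "\<And>x. x < (n + 1) * b ^ (L + 1) \<Longrightarrow> m3 (64 * n + x) = pass_value b L (l (Suc k))
      (rounded U w (Suc k)) (m2 r_item) (m2 r_mix) (m2 r_new) (\<lambda>y. m2 (64 * n + y)) x"
    using ready_table_pass[OF ready2 same2(1) k(3) regs2(1)] by blast
  define m4 where "m4 = fold step ?count m3"
  have count: "exec_within (straight ?count) m3 1 m4"
    unfolding m4_def by (rule exec_within_straight) simp_all
  note load also note prepare also note pass also note count
  finally have exec: "exec_within add_item m (16 + pass_time n L b) m4"
    unfolding add_item_def by (rule exec_within_mono) simp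
  have "agree_outside {r_item} m3 m4" by (simp add: m4_def agree_outside_def)
  then have ready4: "ready n l w L b U m4" by (rule ready_frame[OF ready3]) auto
  have "m3 r_one = 1" using ready3 by (simp add: ready_def configured_def)
  then have "m4 r_item = real k"
    using agree3 same2(2) k(2) by (simp add: m4_def agree_outside_def)
  then show ?thesis
    by (rule that[OF exec ready4]) (use k(2) in \<open>simp add: m4_def cells3 same2 regs2 pass_value_def\<close>)
qed

definition table_mean :: "nat \<Rightarrow> (nat \<Rightarrow> nat) \<Rightarrow> (nat \<Rightarrow> nat) \<Rightarrow> nat \<Rightarrow> nat \<Rightarrow> nat \<Rightarrow> mem \<Rightarrow> real" where
  "table_mean n l w L b k m = coalition_mean {1..k} (\<lambda>S. m (64 * n + coalition_state b L l w S))"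

lemma add_item_table_mean:
  assumes ready: "ready n l w L b U m" and k: "m r_item = real (Suc k)" "Suc k \<le> n" "l (Suc k) \<le> L"
    and below: "tables_below b L l (rounded U w) {1..n}"
  obtains m' where "exec_within add_item m (16 + pass_time n L b) m'" "ready n l w L b U m'"
    "m' r_item = real k"
    "table_mean n l (rounded U w) L b k m' = table_mean n l (rounded U w) L b (Suc k) m"
proof -
  let ?state = "coalition_state b L l (rounded U w)"
  have "Suc k \<in> {1..n}" using k(2) by simp
  then obtain m' where m': "exec_within add_item m (16 + pass_time n L b) m'" "ready n l w L b U m'"
    "m' r_item = real k"
    and cells: "\<And>x. x < (n + 1) * b ^ (L + 1) \<Longrightarrow> m' (64 * n + x) =
      ((real (x div b ^ (L + 1)) + 1) * m (64 * n + next_state b L (l (Suc k)) (rounded U w (Suc k)) x)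
       + (real k + 1 - real (x div b ^ (L + 1))) * m (64 * n + x)) / (real k + 2)"
    using add_item_correct[OF ready k(1) _ k(3)] by blast
  have "m' (64 * n + ?state S) = ((real (card S) + 1) * m (64 * n + ?state (insert (Suc k) S))
      + (real k + 1 - real (card S)) * m (64 * n + ?state S)) / (real k + 2)" if S: "S \<subseteq> {1..k}" for S
  proof -
    have Sn: "S \<subseteq> {1..n}" and S': "finite S" "Suc k \<notin> S" and "card S \<le> n"
      using S k(2) card_mono[of "{1..k}" S] by (auto intro: finite_subset)
    then show ?thesis
      using cells[OF coalition_state_less[OF below Sn]] coalition_state_div_block[OF below Sn]
        next_state_coalition_state[OF below Sn S' k(3)] by (simp only:)
  qed
  then have "table_mean n l (rounded U w) L b k m' = coalition_mean {1..k} (\<lambda>S.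
      ((real (card S) + 1) * m (64 * n + ?state (insert (Suc k) S))
       + (real k + 1 - real (card S)) * m (64 * n + ?state S)) / (real k + 2))"
    unfolding table_mean_def by (rule coalition_mean_cong)
  also have "\<dots> = table_mean n l (rounded U w) L b (Suc k) m"
    by (simp add: table_mean_def atLeastAtMostSuc_conv coalition_mean_insert)
  finally show ?thesis by (rule that[OF m'])
qed

lemma fold_items_correct:
  assumes ready: "ready n l w L b U m" and l: "\<And>k. k \<in> {1..n} \<Longrightarrow> l k \<le> L"
    and below: "tables_below b L l (rounded U w) {1..n}"
  obtains m' where "exec_within fold_items m (n * (17 + pass_time n L b) + 2) m'" "ready n l w L b U m'"
    "m' (64 * n) = table_mean n l (rounded U w) L b n m"
proof -
  define m1 where "m1 = fold step [copy r_item r_n] m"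
  have start: "exec_within (straight [copy r_item r_n]) m 1 m1"
    unfolding m1_def by (rule exec_within_straight) simp_all
  have agree1: "agree_outside {r_item} m m1" by (simp add: m1_def agree_outside_def)
  then have ready1: "ready n l w L b U m1" by (rule ready_frame[OF ready]) auto
  have item1: "m1 r_item = real n" using ready by (simp add: m1_def ready_def configured_def)
  have mean1: "table_mean n l (rounded U w) L b n m1 = table_mean n l (rounded U w) L b n m"
    using ready by (simp add: m1_def ready_def table_mean_def)
  define I where "I k m' \<longleftrightarrow> ready n l w L b U m'
    \<and> table_mean n l (rounded U w) L b k m' = table_mean n l (rounded U w) L b n m" for k m'
  obtain m' where loop: "exec_within (WhilePos r_item add_item) m1 (n * Suc (16 + pass_time n L b) + 1) m'"
    and "I 0 m'"
  proof (rule exec_within_countdown[where I = I and m = m1])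
    fix k m2 assume k: "k < n" and I: "I (Suc k) m2" and item2: "m2 r_item = real (Suc k)"
    have ready2: "ready n l w L b U m2" and len2: "l (Suc k) \<le> L" using I l k by (simp_all add: I_def)
    obtain m3 where "exec_within add_item m2 (16 + pass_time n L b) m3" "ready n l w L b U m3"
      "m3 r_item = real k"
      "table_mean n l (rounded U w) L b k m3 = table_mean n l (rounded U w) L b (Suc k) m2"
      using add_item_table_mean[OF ready2 item2 Suc_leI[OF k] len2 below] .
    then show "\<exists>m'. exec_within add_item m2 (16 + pass_time n L b) m' \<and> I k m' \<and> m' r_item = real k"
      using I unfolding I_def by metis
  qed (use ready1 item1 mean1 in \<open>simp_all add: I_def\<close>)
  note start also note loop
  finally have "exec_within fold_items m (n * (17 + pass_time n L b) + 2) m'"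
    unfolding fold_items_def by (rule exec_within_mono) simp
  then show ?thesis using \<open>I 0 m'\<close> by (intro that[of m']) (simp_all add: I_def table_mean_def)
qed

lemma average_marginals_correct:
  assumes ready: "ready n l w L b U m" and i: "m r_agent = real i" "i \<in> {1..n}"
    and l: "\<And>k. k \<in> {1..n} \<Longrightarrow> l k \<le> L" and below: "tables_below b L l (rounded U w) {1..n}"
  obtains m' where "exec_within average_marginals m (20 + pass_time n L b + n * (17 + pass_time n L b)) m'"
    "configured n L b U m'" "m' (64 * n) = shapley {1..n} (knap_val l (rounded U w) L) i"
proof -
  let ?l = "l(i := 0)" and ?w = "w(i := 0)"
  obtain m1 where marginals: "exec_within set_marginals m (18 + pass_time n L b) m1"
    and ready1: "ready n ?l ?w L b U m1"
    and cells1: "\<And>x. x < (n + 1) * b ^ (L + 1)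
      \<Longrightarrow> m1 (64 * n + x) = real (gain b (l i) (rounded U w i) x (L - l i))"
    using set_marginals_correct[OF ready i l[OF i(2)]] by blast
  have below0: "tables_below b L ?l (rounded U ?w) {1..n}"
    using tables_below_null_item[OF _ below] by (simp add: rounded_null)
  have len0: "?l k \<le> L" if "k \<in> {1..n}" for k using l[OF that] by simp
  obtain m2 where items: "exec_within fold_items m1 (n * (17 + pass_time n L b) + 2) m2"
    and ready2: "ready n ?l ?w L b U m2" and mean2: "m2 (64 * n) = table_mean n ?l (rounded U ?w) L b n m1"
    using fold_items_correct[OF ready1 len0 below0] .
  note mean2
  also have "table_mean n ?l (rounded U ?w) L b n m1 = coalition_mean {1..n} (\<lambda>S.
      real (gain b (l i) (rounded U w i) (coalition_state b L ?l (rounded U ?w) S) (L - l i)))"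
    unfolding table_mean_def
  proof (intro coalition_mean_cong cells1 coalition_state_less[OF below0])
    show "card S \<le> n" if "S \<subseteq> {1..n}" for S using card_mono[OF _ that] by simp
  qed
  also have "\<dots> = shapley {1..n} (knap_val l (rounded U w) L) i"
    unfolding rounded_null using i(2) l below by (intro coalition_mean_gain_eq_shapley) auto
  finally have result: "m2 (64 * n) = shapley {1..n} (knap_val l (rounded U w) L) i" .
  note marginals also note items
  finally have "exec_within average_marginals m (20 + pass_time n L b + n * (17 + pass_time n L b)) m2"
    unfolding average_marginals_def by (rule exec_within_mono) simp
  then show ?thesis using ready2 result by (intro that[of m2]) (simp_all add: ready_def)
qed

lemma set_parameters_correct:
  assumes regs: "m r_n = real n" "m r_cap = real L" "m r_eps = eps" "m r_one = 1"
      "m r_table = real (64 * n)" "m r_saved = 32 * real n - 4"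
    and stored: "items_stored n l w m" and n: "n \<ge> 1" and eps: "eps > 0"
  obtains m' where "exec_within set_parameters m (3 * L + 16 * n + 14) m'"
    "ready n l w L (nat \<lfloor>real L / eps\<rfloor> + 1) (eps * max_density l w {1..n}) m'" "m' r_agent = m r_agent"
proof -
  let ?b = "nat \<lfloor>real L / eps\<rfloor> + 1"
  obtain m1 where base: "exec_within set_base m (3 * L + 10) m1"
    and agree1: "agree_outside {r_base, r_block, r_pow, r_count} m m1"
    and base1: "m1 r_base = real ?b" "m1 r_block = real (?b ^ (L + 1))"
    using set_base_correct[of m L] regs(2-4) eps by auto
  have regs1: "m1 r_n = real n" "m1 r_one = 1" "m1 r_saved = 32 * real n - 4"
    using agree1 regs by (simp_all add: agree_outside_def)
  have stored1: "items_stored n l w m1" by (rule items_stored_frame[OF stored agree1]) auto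
  obtain m2 where unit: "exec_within set_unit m1 (16 * n + 4) m2" and agree2: "agree_outside unit_regs m1 m2"
    and unit2: "m2 r_unit = m1 r_eps * max_density l w {1..n}"
    using set_unit_correct[OF regs1 stored1 n] .
  have "eps * max_density l w {1..n} \<ge> 0" using max_density_nonneg[of "{1..n}" l w] n eps by simp
  moreover have "items_stored n l w m2" by (rule items_stored_frame[OF stored1 agree2]) auto
  ultimately have "ready n l w L ?b (eps * max_density l w {1..n}) m2" "m2 r_agent = m r_agent"
    using n agree1 agree2 regs base1 unit2
    by (simp_all add: ready_def configured_def agree_outside_def)
  moreover have "exec_within set_parameters m (3 * L + 16 * n + 14) m2"
    unfolding set_parameters_def by (rule exec_within_mono[OF exec_within_Seq[OF base unit]]) simp
  ultimately show ?thesis by (intro that)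
qed

definition rounded_shapley_time :: "nat \<Rightarrow> nat \<Rightarrow> nat \<Rightarrow> nat" where
  "rounded_shapley_time n L b = 3 * L + 16 * n + 36 + pass_time n L b + n * (17 + pass_time n L b)"

lemma rounded_shapley_correct:
  assumes regs: "m r_n = real n" "m r_cap = real L" "m r_eps = eps" "m r_one = 1"
      "m r_table = real (64 * n)" "m r_saved = 32 * real n - 4" and agent: "m r_agent = real i" "i \<in> {1..n}"
    and stored: "items_stored n l w m" and l: "\<And>k. k \<in> {1..n} \<Longrightarrow> 0 < l k \<and> l k \<le> L" and eps: "eps > 0"
  defines "U \<equiv> eps * max_density l w {1..n}"
  obtains m' where "exec_within rounded_shapley m (rounded_shapley_time n L (nat \<lfloor>real L / eps\<rfloor> + 1)) m'"
    "m' r_n = U * shapley {1..n} (knap_val l (rounded U w) L) i"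
proof -
  define b where "b = nat \<lfloor>real L / eps\<rfloor> + 1"
  have n: "n \<ge> 1" using agent(2) by simp
  have below: "tables_below b L l (rounded U w) {1..n}"
    unfolding b_def U_def using l eps by (intro tables_below_rounded) auto
  obtain m1 where parameters: "exec_within set_parameters m (3 * L + 16 * n + 14) m1"
    and ready1: "ready n l w L b U m1" and agent1: "m1 r_agent = real i"
    using set_parameters_correct[OF regs stored n eps] unfolding b_def U_def agent(1) .
  have len: "l k \<le> L" if "k \<in> {1..n}" for k using l[OF that] by simp
  obtain m2 where average:
      "exec_within average_marginals m1 (20 + pass_time n L b + n * (17 + pass_time n L b)) m2"
    and conf2: "configured n L b U m2"
    and result: "m2 (64 * n) = shapley {1..n} (knap_val l (rounded U w) L) i"
    using average_marginals_correct[OF ready1 agent1 agent(2) len below] .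
  let ?scale = "[LoadInd r_n r_table, SetOp r_n Mul r_n r_unit]"
  have scale: "exec_within (straight ?scale) m2 2 (fold step ?scale m2)"
    by (rule exec_within_straight) simp_all
  note parameters also note average also note scale
  finally have "exec_within rounded_shapley m (rounded_shapley_time n L b) (fold step ?scale m2)"
    unfolding rounded_shapley_def by (rule exec_within_mono) (simp add: rounded_shapley_time_def)
  moreover have "nat \<lfloor>m2 r_table\<rfloor> = 64 * n" "m2 r_unit = U"
    using conf2 by (simp_all only: configured_def floor_of_nat nat_int)
  then have "fold step ?scale m2 r_n = U * shapley {1..n} (knap_val l (rounded U w) L) i"
    using result by simp
  ultimately show ?thesis unfolding b_def by (rule that)
qed

section \<open>Relocating the input\<close>

lemma fold_save_cells:
  assumes "m r_n = real a" "a \<ge> 32" "q \<le> 28"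
  shows "fold step (concat (map save_cell [0..<q])) m
    = (\<lambda>x. if x \<in> {a..<a + q} then m (4 + (x - a)) else m x)
        (r_n := real (a + q), r_one := if q = 0 then m r_one else 1)"
  using assms(3)
proof (induction q)
  case 0
  then show ?case using assms(1) by (auto simp: fun_eq_iff)
next
  case (Suc q)
  then show ?case using assms(2) by (auto simp: save_cell_def fun_eq_iff nat_int_add)
qed

lemma evacuate_basic: "list_all basic evacuate" "length evacuate = 89"
  by (auto simp: evacuate_def save_cell_def list_all_iff length_concat comp_def sum_list_triv)

lemma evacuate_correct:
  assumes "n \<ge> 1" and m'_eq: "m' = fold step evacuate (init_mem n l w L i eps)"
  shows "agree_outside ({r_n, r_one} \<union> {32 * n..<32 * n + 28}) (init_mem n l w L i eps) m'"
    "m' r_n = real (32 * n + 28)" "m' r_one = 1" "items_stored n l w m'"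
proof -
  let ?m = "init_mem n l w L i eps"
  have "fold step (replicate 5 (SetOp r_n Add r_n r_n)) ?m = ?m(r_n := real (32 * n))"
    by (simp add: numeral_eq_Suc init_mem_def)
  then have m': "m' = (\<lambda>x. if x \<in> {32 * n..<32 * n + 28} then ?m (4 + (x - 32 * n)) else ?m x)
      (r_n := real (32 * n + 28), r_one := 1)"
    using assms(1) fold_save_cells[of "?m(r_n := real (32 * n))" "32 * n" 28]
    by (auto simp: m'_eq evacuate_def)
  then show "agree_outside ({r_n, r_one} \<union> {32 * n..<32 * n + 28}) ?m m'"
    "m' r_n = real (32 * n + 28)" "m' r_one = 1"
    by (auto simp: agree_outside_def)
  show "items_stored n l w m'"
    unfolding items_stored_def
  proof
    fix k assume k: "k \<in> {1..n}"
    then obtain j where j: "k = Suc j" by (cases k) auto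
    have "m' (address n k) = ?m (4 + 2 * j) \<and> m' (Suc (address n k)) = ?m (Suc (4 + 2 * j))"
    proof (cases "j < 14")
      case True
      then have "address n k = 32 * n + 2 * j" using assms(1) by (simp add: address_def j)
      then show ?thesis using True assms(1) by (simp add: m')
    next
      case False
      then have "address n k = 4 + 2 * j" by (simp add: address_def j)
      then show ?thesis using False k by (simp add: m' j)
    qed
    moreover have "?m (4 + 2 * j) = real (l k)" "?m (Suc (4 + 2 * j)) = real (w k)"
      using k by (simp_all add: init_mem_def j)
    ultimately show "m' (address n k) = real (l k) \<and> m' (Suc (address n k)) = real (w k)" by simp
  qed
qed

lemma relocation_correct:
  fixes l w :: "nat \<Rightarrow> nat"
  assumes "n \<ge> 1"
  obtains m' where "exec_within (straight evacuate ;; straight set_addresses) (init_mem n l w L i eps) 97 m'"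
    "m' r_n = real n" "m' r_cap = real L" "m' r_eps = eps" "m' r_one = 1" "m' r_table = real (64 * n)"
    "m' r_saved = 32 * real n - 4" "m' r_agent = real i" "m' r_tmp = 1 - eps" "items_stored n l w m'"
proof -
  let ?m = "init_mem n l w L i eps"
  define m1 where "m1 = fold step evacuate ?m"
  define m2 where "m2 = fold step set_addresses m1"
  have evacuate: "exec_within (straight evacuate) ?m 89 m1"
    unfolding m1_def by (rule exec_within_straight) (simp_all add: evacuate_basic)
  have addresses: "exec_within (straight set_addresses) m1 8 m2"
    unfolding m2_def by (rule exec_within_straight) (simp_all add: set_addresses_def)
  have exec: "exec_within (straight evacuate ;; straight set_addresses) ?m 97 m2"
    by (rule exec_within_mono[OF exec_within_Seq[OF evacuate addresses]]) simp
  note evacuated = evacuate_correct[OF assms m1_def]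
  have "m1 r_cap = real L" "m1 r_agent = real i" "m1 r_eps = eps"
    using evacuated(1) assms by (auto simp: agree_outside_def init_mem_def)
  then have regs2: "m2 r_n = real n" "m2 r_cap = real L" "m2 r_eps = eps" "m2 r_one = 1"
    "m2 r_table = real (64 * n)" "m2 r_saved = 32 * real n - 4" "m2 r_agent = real i" "m2 r_tmp = 1 - eps"
    using evacuated(2,3) by (simp_all add: m2_def set_addresses_def)
  have "agree_outside {r_n, r_table, r_saved, r_tmp} m1 m2"
    by (simp add: m2_def set_addresses_def agree_outside_def)
  then have "items_stored n l w m2" by (rule items_stored_frame[OF evacuated(4)]) auto
  then show ?thesis by (rule that[OF exec regs2])
qed

definition approx_shapley_time :: "nat \<Rightarrow> nat \<Rightarrow> real \<Rightarrow> nat" where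
  "approx_shapley_time n L eps =
    100 + (if eps < 1 then rounded_shapley_time n L (nat \<lfloor>real L / eps\<rfloor> + 1) else 0)"

definition approx_shapley_value :: "nat \<Rightarrow> (nat \<Rightarrow> nat) \<Rightarrow> (nat \<Rightarrow> nat) \<Rightarrow> nat \<Rightarrow> nat \<Rightarrow> real \<Rightarrow> real" where
  "approx_shapley_value n l w L i eps = (let U = eps * max_density l w {1..n} in
    if eps < 1 then U * shapley {1..n} (knap_val l (rounded U w) L) i else 0)"

lemma approx_shapley_correct:
  assumes i: "i \<in> {1..n}" and l: "\<And>k. k \<in> {1..n} \<Longrightarrow> 0 < l k \<and> l k \<le> L" and eps: "eps > 0"
  obtains m' where "exec_within approx_shapley (init_mem n l w L i eps) (approx_shapley_time n L eps) m'"
    "m' r_n = approx_shapley_value n l w L i eps"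
proof -
  let ?m = "init_mem n l w L i eps" and ?U = "eps * max_density l w {1..n}"
  have n: "n \<ge> 1" using i by simp
  obtain m1 where relocation: "exec_within (straight evacuate ;; straight set_addresses) ?m 97 m1"
    and regs1: "m1 r_n = real n" "m1 r_cap = real L" "m1 r_eps = eps" "m1 r_one = 1"
      "m1 r_table = real (64 * n)"
      "m1 r_saved = 32 * real n - 4" "m1 r_agent = real i"
    and test: "m1 r_tmp = 1 - eps" and stored: "items_stored n l w m1"
    using relocation_correct[OF n] .
  show ?thesis
  proof (cases "eps < 1")
    case True
    let ?t = "rounded_shapley_time n L (nat \<lfloor>real L / eps\<rfloor> + 1)"
    obtain m2 where main: "exec_within rounded_shapley m1 ?t m2"
      and result: "m2 r_n = ?U * shapley {1..n} (knap_val l (rounded ?U w) L) i"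
      using rounded_shapley_correct[OF regs1 i stored l eps] .
    have "exec_within (IfPos r_tmp rounded_shapley (straight [SetConst r_n 0])) m1 (Suc ?t) m2"
      using main test True by (intro exec_within_IfPos) auto
    then have "exec_within approx_shapley ?m (100 + ?t) m2"
      unfolding approx_shapley_def by (rule exec_within_mono[OF exec_within_Seq[OF relocation]]) simp
    then show ?thesis
      using True result
      by (intro that[of m2]) (simp_all add: approx_shapley_time_def approx_shapley_value_def Let_def)
  next
    case False
    have "exec_within (IfPos r_tmp rounded_shapley (straight [SetConst r_n 0])) m1 (Suc 1) (m1(r_n := 0))"
      using exec_within_straight[of "[SetConst r_n 0]" 1 m1] test False by (intro exec_within_IfPos) auto
    then have "exec_within approx_shapley ?m 100 (m1(r_n := 0))"
      unfolding approx_shapley_def by (rule exec_within_mono[OF exec_within_Seq[OF relocation]]) simp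
    then show ?thesis
      using False by (intro that[of "m1(r_n := 0)"])
        (simp_all add: approx_shapley_time_def approx_shapley_value_def Let_def)
  qed
qed

lemma approx_shapley_value_error:
  assumes i: "i \<in> {1..n}" and l: "\<And>k. k \<in> {1..n} \<Longrightarrow> 0 < l k \<and> l k \<le> L" and eps: "eps > 0"
  shows "\<bar>approx_shapley_value n l w L i eps - shapley {1..n} (knap_val l w L) i\<bar>
    \<le> eps * real_of_int (w_max n l w L)"
proof (cases "eps < 1")
  case True
  then show ?thesis
    using shapley_rounding_error[OF i _ eps] l by (simp add: approx_shapley_value_def Let_def)
next
  case False
  have bound: "\<bar>shapley {1..n} (knap_val l w L) i\<bar> \<le> real_of_int (w_max n l w L)"
    using i l by (intro abs_shapley_le_w_max) auto
  then have "1 * real_of_int (w_max n l w L) \<le> eps * real_of_int (w_max n l w L)"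
    using False by (intro mult_right_mono) linarith+
  then show ?thesis using False bound by (simp add: approx_shapley_value_def Let_def)
qed

section \<open>Running time\<close>

lemma rounded_shapley_time_le:
  assumes "n \<ge> 1" "L \<ge> 1" "b \<ge> 1"
  shows "rounded_shapley_time n L b \<le> 500 * (L * b ^ (L + 1) * n ^ 2)"
proof -
  let ?B = "b ^ (L + 1)"
  define X where "X = L * ?B * n"
  have "?B \<ge> 1" using assms(3) by simp
  then have X: "L \<le> X" "n \<le> X" "1 \<le> X" unfolding X_def using assms by auto
  have "(n + 1) * ?B * (19 * L + 45) \<le> (2 * n) * ?B * (64 * L)"
    using assms by (intro mult_mono) auto
  also have "\<dots> = 128 * X" unfolding X_def by simp
  finally have pass: "pass_time n L b \<le> 138 * X"
    unfolding pass_time_def using X by linarith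
  have "rounded_shapley_time n L b \<le> 3 * X + 16 * X + 36 * X + 138 * X + n * (17 * X + 138 * X)"
    unfolding rounded_shapley_time_def using pass X by (intro add_mono mult_left_mono) auto
  also have "\<dots> \<le> n * (193 * X) + n * (155 * X)" using assms(1) by simp
  also have "\<dots> \<le> 500 * (n * X)" by simp
  also have "n * X = L * ?B * n ^ 2" unfolding X_def by (simp add: power2_eq_square)
  finally show ?thesis .
qed

text \<open>One of the \<open>L + 1\<close> factors \<open>b \<le> L / \<epsilon> + 1\<close> absorbs the factor \<open>L\<close>; this needs \<open>\<epsilon> < 1\<close>.\<close>

lemma cap_mult_base_power_le:
  assumes "L \<ge> 1" "0 < eps" "eps < 1"
  shows "real L * real (nat \<lfloor>real L / eps\<rfloor> + 1) ^ (L + 1) \<le> 2 * (real L ^ 2 / eps + 1) ^ (L + 1)"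
proof -
  define b where "b = nat \<lfloor>real L / eps\<rfloor> + 1"
  define q where "q = real L ^ 2 / eps"
  have "real L \<le> real L ^ 2" using assms(1) by (simp add: power2_eq_square)
  moreover have "real L ^ 2 \<le> q"
    unfolding q_def using assms(2,3) by (simp add: field_simps mult_left_le_one_le)
  moreover have "real L / eps \<le> q"
    unfolding q_def using calculation(1) assms(2) by (simp add: divide_right_mono)
  moreover have b: "real b \<le> real L / eps + 1" unfolding b_def using assms(2) by simp
  ultimately have q: "real L \<le> q" "real b \<le> q + 1" by linarith+
  have "real L * real b \<le> real L * (real L / eps + 1)"
    using b by (intro mult_left_mono) auto
  also have "\<dots> = q + real L" unfolding q_def by (simp add: power2_eq_square distrib_left)
  also have "\<dots> \<le> 2 * (q + 1)" using q(1) by simp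
  finally have "real L * real b \<le> 2 * (q + 1)" .
  moreover have "real b ^ L \<le> (q + 1) ^ L" using q(2) by (intro power_mono) auto
  ultimately have "(real L * real b) * real b ^ L \<le> (2 * (q + 1)) * (q + 1) ^ L"
    by (rule mult_mono) (use q(1) in auto)
  then show ?thesis
    unfolding b_def[symmetric] q_def[symmetric] by (simp only: Suc_eq_plus1[symmetric] power_Suc mult.assoc)
qed

lemma approx_shapley_time_le:
  assumes "n \<ge> 1" "L \<ge> 1" "eps > 0"
  shows "real (approx_shapley_time n L eps) \<le> 1100 * ((real L ^ 2 / eps + 1) ^ (L + 1) * real n ^ 2)"
proof -
  define Z where "Z = (real L ^ 2 / eps + 1) ^ (L + 1)"
  define b where "b = nat \<lfloor>real L / eps\<rfloor> + 1"
  have "Z \<ge> 1" unfolding Z_def using assms(3) by (intro one_le_power) simp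
  then have base: "1 * 1 \<le> Z * real n ^ 2" using assms(1) by (intro mult_mono one_le_power) auto
  have "real (rounded_shapley_time n L b) \<le> 1000 * (Z * real n ^ 2)" if "eps < 1"
  proof -
    have "real (rounded_shapley_time n L b) \<le> real (500 * (L * b ^ (L + 1) * n ^ 2))"
      using rounded_shapley_time_le[OF assms(1,2), of b] by (simp only: of_nat_le_iff b_def)
    also have "\<dots> = 500 * (real L * real b ^ (L + 1) * real n ^ 2)" by simp
    also have "\<dots> \<le> 500 * (2 * Z * real n ^ 2)"
      unfolding Z_def b_def using cap_mult_base_power_le[OF assms(2,3) that]
      by (intro mult_left_mono mult_right_mono) auto
    finally show ?thesis by simp
  qed
  then show ?thesis using base unfolding approx_shapley_time_def Z_def[symmetric] b_def[symmetric] by auto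
qed

theorem theorem3:
  "\<exists>(P::com) (C::real). C > 0 \<and>
     (\<forall>(n::nat) (l::nat \<Rightarrow> nat) (w::nat \<Rightarrow> nat) (lbin::nat) (i::nat) (eps::real).
        1 \<le> n \<longrightarrow> i \<in> {1..n} \<longrightarrow> (\<forall>k\<in>{1..n}. 0 < l k \<and> l k \<le> lbin) \<longrightarrow> eps > 0 \<longrightarrow>
        (\<exists>t m'. exec P (init_mem n l w lbin i eps) t m' \<and>
           real t \<le> C * ((real lbin ^ 2 / eps + 1) ^ (lbin + 1) * real n ^ 2) \<and>
           \<bar>m' 0 - shapley {1..n} (knap_val l w lbin) i\<bar> \<le> eps * real_of_int (w_max n l w lbin)))"
proof (intro exI[of _ approx_shapley] exI[of _ "1100::real"] conjI allI impI)
  fix n :: nat and l w :: "nat \<Rightarrow> nat" and lbin i :: nat and eps :: real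
  assume n: "1 \<le> n" and i: "i \<in> {1..n}" and "\<forall>k\<in>{1..n}. 0 < l k \<and> l k \<le> lbin" and eps: "eps > 0"
  then have l: "0 < l k \<and> l k \<le> lbin" if "k \<in> {1..n}" for k using that by blast
  then have "lbin \<ge> 1" using i by fastforce
  obtain m' where "exec_within approx_shapley (init_mem n l w lbin i eps) (approx_shapley_time n lbin eps) m'"
    and result: "m' 0 = approx_shapley_value n l w lbin i eps"
    by (rule approx_shapley_correct[where l = l, OF i l eps])
  then obtain t where run: "exec approx_shapley (init_mem n l w lbin i eps) t m'"
    "t \<le> approx_shapley_time n lbin eps"
    unfolding exec_within_def by blast
  have "real t \<le> real (approx_shapley_time n lbin eps)" using run(2) by simp
  also have "\<dots> \<le> 1100 * ((real lbin ^ 2 / eps + 1) ^ (lbin + 1) * real n ^ 2)"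
    using n \<open>lbin \<ge> 1\<close> eps by (rule approx_shapley_time_le)
  finally show "\<exists>t m'. exec approx_shapley (init_mem n l w lbin i eps) t m' \<and>
      real t \<le> 1100 * ((real lbin ^ 2 / eps + 1) ^ (lbin + 1) * real n ^ 2) \<and>
      \<bar>m' 0 - shapley {1..n} (knap_val l w lbin) i\<bar> \<le> eps * real_of_int (w_max n l w lbin)"
    using run(1) approx_shapley_value_error[where l = l and w = w, OF i l eps] unfolding result[symmetric]
    by blast
qed simp

end
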